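(* For any $F\in\mathcal{S}$, $$F=\mathbb{E}[F]+\sum_{k=0}^{\infty}\big\langle \mathbb{E}[D_kF\,|\,\mathcal{F}_{k-1}],Y_k\big\rangle=\mathbb{E}[F]+\sum_{k=0}^{\infty}\big\langle D_k\mathbb{E}[F\,|\,\mathcal{F}_{k}],Y_k\big\rangle ,$$ where the series converge in $L^2(\Omega)$.
   Context: Let $d\ge 1$, $\Omega=\{0,\dots,d\}^{\mathbb{N}}$ ($0\in\mathbb{N}$) with its product $\sigma$-field $\mathcal{F}$, coordinate maps $X_n(w)=w_n$, $\mathcal{F}_n=\sigma(X_0,\dots,X_n)$, $\mathcal{F}_{-1}=\{\varnothing,\Omega\}$, and a probability $\mathbb{P}$ such that $p_n^i=\mathbb{P}(X_n=i\,|\,\mathcal{F}_{n-1})>0$ for all $n,i$. For each $n$ let $v_0(n),\dots,v_d(n)$ be $\mathcal{F}_{n-1}$-measurable $\mathbb{R}^d$-valued random variables and $Y_n=v_{X_n}(n)=(Y_n^1,\dots,Y_n^d)$. Assume (obtuse random walk) $\sigma(Y_0,\dots,Y_n)=\mathcal{F}_n$, $\mathbb{E}[Y_n^i\,|\,\mathcal{F}_{n-1}]=0$ and $\mathbb{E}[Y_n^iY_n^j\,|\,\mathcal{F}_{n-1}]=\delta^{ij}$ for all $n\ge0$, $1\le i,j\le d$. $\langle\cdot,\cdot\rangle$ is the Euclidean inner product of $\mathbb{R}^d$ and $L^2(\Omega)=L^2(\Omega,\mathcal{F},\mathbb{P})$. Multiple integrals: $\Delta_r=\{(i_1,\dots,i_r)\in\mathbb{N}^r: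 i_l\ne i_k \text{ for } l\neq k\}$. A function $f_r=(f_r^{k_1,\dots,k_r})_{1\le k_1,\dots,k_r\le d}:\Delta_r\to\mathbb{R}^{d^r}$ is symmetric if $f_r^{k_{\sigma(1)},\dots,k_{\sigma(r)}}(i_{\sigma(1)},\dots,i_{\sigma(r)})=f_r^{k_1,\dots,k_r}(i_1,\dots,i_r)$ for every permutation $\sigma$. For symmetric square-summable $f_r\in L^2(\Delta_r,\mathbb{R}^{d^r})$, $r\ge1$, $$\mathcal{I}^r(f_r)=\sum_{k_1,\dots,k_r=1}^d\ \sum_{(i_1,\dots,i_r)\in\Delta_r}f_r^{k_1,\dots,k_r}(i_1,\dots,i_r)Y_{i_1}^{k_1}\cdots Y_{i_r}^{k_r}$$ (convergence in $L^2(\Omega)$), and $\mathcal{I}^0(f_0)=f_0$ for $f_0\in\mathbb{R}$. $\mathcal{S}$ is the space of finite sums $\sum_{r=0}^n\mathcal{I}^r(f_r)$ with $f_r$ symmetric in $L^2(\Delta_r,\mathbb{R}^{d^r})$. Gradient: $D_k=(D_k^1,\dots,D_k^d)$, $k\in\mathbb{N}$, is the linear operator on $\mathcal{S}$ with $D_k^j\mathcal{I}^0(f_0)=0$ and $D_k^j\mathcal{I}^r(f_r)=r\,\mathcal{I}^{r-1}\big(f_r^j( *,k)1_{\Delta_r}( *,k)\big)$ for $r\ge1$, where $f_r^j( *,k)1_{\Delta_r}( *,k)$ is the function on $\Delta_{r-1}$ with components $(i_1,\dots,i_{r-1})\mapsto f_r^{k_1,\dots,k_{r-1},j}(i_1,\dots,i_{r-1},k)$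 if $k\notin\{i_1,\dots,i_{r-1}\}$ and $0$ otherwise. Conditional expectations of vectors are componentwise. *)

theory Defs
  imports "HOL-Probability.Probability" "HOL-Combinatorics.Permutations"
begin

text \<open>
  The dimension \<open>d \<ge> 1\<close> is \<open>CARD('d)\<close>, where \<open>'d\<close> is the finite index type of the vectors in
  \<open>real ^ 'd\<close>; the sample points are the sequences \<open>\<omega> :: nat \<Rightarrow> nat\<close> with values in
  \<open>{0..CARD('d)}\<close>, and the coordinate map \<open>X\<^sub>n\<close> is \<open>\<lambda>\<omega>. \<omega> n\<close>.
  Elements of \<open>L\<^sup>2(\<Omega>)\<close> are represented by square integrable functions, up to equality almost
  everywhere.
\<close>

definition gen_sigma ::
    "'a set \<Rightarrow> 'i set \<Rightarrow> ('i \<Rightarrow> 'a \<Rightarrow> 'b) \<Rightarrow> 'b measure \<Rightarrow> 'a measure" where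
  "gen_sigma \<Omega> I Z N = sigma \<Omega> {Z i -` A \<inter> \<Omega> | i A. i \<in> I \<and> A \<in> sets N}"

text \<open>
  The index is shifted by one: \<open>past P n\<close> is \<open>\<F>\<^sub>n\<^sub>-\<^sub>1 = \<sigma>(X\<^sub>0, \<dots>, X\<^sub>n\<^sub>-\<^sub>1)\<close>. In particular
  \<open>past P 0\<close> is the trivial \<open>\<sigma>\<close>-field, and \<open>\<F>\<^sub>n\<close> is \<open>past P (Suc n)\<close>.
\<close>

definition past :: "(nat \<Rightarrow> nat) measure \<Rightarrow> nat \<Rightarrow> (nat \<Rightarrow> nat) measure" where
  "past P n = gen_sigma (space P) {..<n} (\<lambda>i \<omega>. \<omega> i) (count_space UNIV)"

text \<open>The argument \<open>v n i\<close> is the random vector \<open>v\<^sub>i(n)\<close>, and \<open>walk v n\<close> is \<open>Y\<^sub>n = v\<^bsub>X\<^sub>n\<^esub>(n)\<close>.\<close>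

definition walk :: "(nat \<Rightarrow> nat \<Rightarrow> (nat \<Rightarrow> nat) \<Rightarrow> real ^ 'd) \<Rightarrow> nat \<Rightarrow> (nat \<Rightarrow> nat) \<Rightarrow> real ^ 'd"
  where "walk v n \<omega> = v n (\<omega> n) \<omega>"

locale obtuse_random_walk = prob_space P
  for P :: "(nat \<Rightarrow> nat) measure" +
  fixes v :: "nat \<Rightarrow> nat \<Rightarrow> (nat \<Rightarrow> nat) \<Rightarrow> real ^ 'd"
  assumes sets_P: "sets P = sets (PiM UNIV (\<lambda>n::nat. count_space {0..CARD('d)}))"
    and cond_prob_pos: "\<And>n i. i \<le> CARD('d) \<Longrightarrow>
      AE \<omega> in P. real_cond_exp P (past P n) (indicator {\<omega> \<in> space P. \<omega> n = i}) \<omega> > 0"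
    and v_measurable: "\<And>n i. i \<le> CARD('d) \<Longrightarrow> v n i \<in> borel_measurable (past P n)"
    and walk_generates: "\<And>n. sets (gen_sigma (space P) {..n} (walk v) borel) = sets (past P (Suc n))"
    and walk_centered: "\<And>n i. AE \<omega> in P. real_cond_exp P (past P n) (\<lambda>\<omega>. walk v n \<omega> $ i) \<omega> = 0"
    and walk_orthonormal: "\<And>n i j. AE \<omega> in P.
      real_cond_exp P (past P n) (\<lambda>\<omega>. walk v n \<omega> $ i * walk v n \<omega> $ j) \<omega> = (if i = j then 1 else 0)"

definition L2 :: "'a measure \<Rightarrow> ('a \<Rightarrow> real) set" where
  "L2 M = {f \<in> borel_measurable M. integrable M (\<lambda>x. (f x)\<^sup>2)}"

definition L2_tendsto :: "'a measure \<Rightarrow> ('b \<Rightarrow> 'a \<Rightarrow> real) \<Rightarrow> ('a \<Rightarrow> real) \<Rightarrow> 'b filter \<Rightarrow> bool" where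
  "L2_tendsto M s G \<A> \<longleftrightarrow>
     G \<in> L2 M \<and> (\<forall>\<^sub>F b in \<A>. s b \<in> L2 M) \<and> ((\<lambda>b. \<integral>x. (s b x - G x)\<^sup>2 \<partial>M) \<longlongrightarrow> 0) \<A>"

definition L2_sums :: "'a measure \<Rightarrow> (nat \<Rightarrow> 'a \<Rightarrow> real) \<Rightarrow> ('a \<Rightarrow> real) \<Rightarrow> bool" where
  "L2_sums M g G \<longleftrightarrow> (\<forall>k. g k \<in> L2 M) \<and> L2_tendsto M (\<lambda>n x. \<Sum>k<n. g k x) G sequentially"

text \<open>
  A kernel \<open>f\<^sub>r\<close> is a function \<open>f :: 'd list \<Rightarrow> nat list \<Rightarrow> real\<close>, of which only the values
  \<open>f [k\<^sub>1, \<dots>, k\<^sub>r] [i\<^sub>1, \<dots>, i\<^sub>r] = f\<^sub>r\<^bsup>k\<^sub>1,\<dots>,k\<^sub>r\<^esup>(i\<^sub>1, \<dots>, i\<^sub>r)\<close> with \<open>[i\<^sub>1, \<dots>, i\<^sub>r] \<in> \<Delta> r\<close> matter. For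
  \<open>r = 0\<close> it amounts to the real number \<open>f [] []\<close>.
\<close>

definition \<Delta> :: "nat \<Rightarrow> nat list set" where
  "\<Delta> r = {is. length is = r \<and> distinct is}"

definition multi_indices :: "nat \<Rightarrow> 'd list set" where
  "multi_indices r = {ks. length ks = r}"

definition symmetric_kernel :: "nat \<Rightarrow> ('d list \<Rightarrow> nat list \<Rightarrow> real) \<Rightarrow> bool" where
  "symmetric_kernel r f \<longleftrightarrow>
     (\<forall>\<sigma>. \<sigma> permutes {..<r} \<longrightarrow> (\<forall>ks \<in> multi_indices r. \<forall>is \<in> \<Delta> r.
        f (permute_list \<sigma> ks) (permute_list \<sigma> is) = f ks is))"

definition sym_L2_kernels :: "nat \<Rightarrow> ('d::finite list \<Rightarrow> nat list \<Rightarrow> real) set" where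
  "sym_L2_kernels r =
     {f. symmetric_kernel r f \<and> (\<lambda>is. \<Sum>ks\<in>multi_indices r. (f ks is)\<^sup>2) summable_on \<Delta> r}"

text \<open>
  The series over \<open>\<Delta> r\<close> is an unordered sum in \<open>L\<^sup>2(\<Omega>)\<close>: the limit along the net of its finite
  partial sums. The choice operator picks a representative of the limit, which is unique up to
  equality almost everywhere.
\<close>

definition multiple_integral ::
    "(nat \<Rightarrow> nat) measure \<Rightarrow> (nat \<Rightarrow> nat \<Rightarrow> (nat \<Rightarrow> nat) \<Rightarrow> real ^ 'd) \<Rightarrow> nat \<Rightarrow>
     ('d list \<Rightarrow> nat list \<Rightarrow> real) \<Rightarrow> (nat \<Rightarrow> nat) \<Rightarrow> real" where
  "multiple_integral P v r f =
     (if r = 0 then \<lambda>_. f [] []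
      else SOME G. L2_tendsto P
        (\<lambda>A \<omega>. \<Sum>ks\<in>multi_indices r. \<Sum>is\<in>A. f ks is * (\<Prod>l<r. walk v (is ! l) \<omega> $ (ks ! l)))
        G (finite_subsets_at_top (\<Delta> r)))"

definition chaos_expansion ::
    "(nat \<Rightarrow> nat) measure \<Rightarrow> (nat \<Rightarrow> nat \<Rightarrow> (nat \<Rightarrow> nat) \<Rightarrow> real ^ 'd) \<Rightarrow>
     ((nat \<Rightarrow> nat) \<Rightarrow> real) \<Rightarrow> nat \<Rightarrow> (nat \<Rightarrow> 'd list \<Rightarrow> nat list \<Rightarrow> real) \<Rightarrow> bool" where
  "chaos_expansion P v F n f \<longleftrightarrow>
     (\<forall>r\<le>n. f r \<in> sym_L2_kernels r) \<and>
     (AE \<omega> in P. F \<omega> = (\<Sum>r\<le>n. multiple_integral P v r (f r) \<omega>))"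

definition chaos_space ::
    "(nat \<Rightarrow> nat) measure \<Rightarrow> (nat \<Rightarrow> nat \<Rightarrow> (nat \<Rightarrow> nat) \<Rightarrow> real ^ 'd) \<Rightarrow>
     ((nat \<Rightarrow> nat) \<Rightarrow> real) set" where
  "chaos_space P v = {F \<in> L2 P. \<exists>n f. chaos_expansion P v F n f}"

definition kernel_slice ::
    "('d list \<Rightarrow> nat list \<Rightarrow> real) \<Rightarrow> 'd \<Rightarrow> nat \<Rightarrow> 'd list \<Rightarrow> nat list \<Rightarrow> real" where
  "kernel_slice f j k = (\<lambda>ks is. if k \<in> set is then 0 else f (ks @ [j]) (is @ [k]))"

text \<open>
  The linear extension of \<open>D\<^sub>k\<^sup>j I\<^sup>0(f\<^sub>0) = 0\<close> and \<open>D\<^sub>k\<^sup>j I\<^sup>r(f\<^sub>r) = r I\<^sup>r\<^sup>-\<^sup>1(f\<^sub>r\<^sup>j(*, k))\<close> to \<open>chaos_space P v\<close>.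
  For an obtuse random walk the kernels of a chaos expansion are determined on \<open>\<Delta> r\<close>, up to
  appending zero kernels, by the almost everywhere class of the random variable, so that the chosen
  expansion affects the value only on a null set.
\<close>

definition gradient ::
    "(nat \<Rightarrow> nat) measure \<Rightarrow> (nat \<Rightarrow> nat \<Rightarrow> (nat \<Rightarrow> nat) \<Rightarrow> real ^ 'd) \<Rightarrow> nat \<Rightarrow>
     ((nat \<Rightarrow> nat) \<Rightarrow> real) \<Rightarrow> (nat \<Rightarrow> nat) \<Rightarrow> real ^ 'd" where
  "gradient P v k F =
     (let (n, f) = (SOME (n, f). chaos_expansion P v F n f) in
      (\<lambda>\<omega>. \<chi> j. \<Sum>r=1..n. real r * multiple_integral P v (r - 1) (kernel_slice (f r) j k) \<omega>))"

definition vec_cond_exp ::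
    "'a measure \<Rightarrow> 'a measure \<Rightarrow> ('a \<Rightarrow> real ^ 'd) \<Rightarrow> 'a \<Rightarrow> real ^ 'd" where
  "vec_cond_exp M N Z = (\<lambda>\<omega>. \<chi> j. real_cond_exp M N (\<lambda>\<omega>'. Z \<omega>' $ j) \<omega>)"

end

theory Submission
  imports Defs
begin

text \<open>
  The idea is to read off both series from the chaos expansion \<open>F = \<Sum>r\<le>n. I\<^sup>r(f\<^sub>r)\<close>. A monomial
  \<open>Y\<^bsub>i\<^sub>1\<^esub>\<^bsup>k\<^sub>1\<^esup> \<cdots> Y\<^bsub>i\<^sub>r\<^esub>\<^bsup>k\<^sub>r\<^esup>\<close> at distinct times is a martingale difference in its latest factor. Hence
  \<open>\<E>[F | \<F>\<^sub>k\<^sub>-\<^sub>1]\<close> is the part of the expansion in which all times are below \<open>k\<close>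
  (\<open>cond_exp_chaos\<close>). This is a finite sum, and the increment \<open>\<E>[F | \<F>\<^sub>k] - \<E>[F | \<F>\<^sub>k\<^sub>-\<^sub>1]\<close> is the
  part whose latest time is exactly \<open>k\<close>. By symmetry of \<open>f\<^sub>r\<close>, each of the \<open>r\<close> places at
  which \<open>k\<close> can occur contributes the same, so the increment equals \<open>r\<close> times the contribution of
  the last place. That contribution is a truncated integral of the slice \<open>f\<^sub>r\<^sup>j(*, k)\<close>
  multiplied by \<open>Y\<^sub>k\<^sup>j\<close> (\<open>partial_sum_increment\<close>). Summed over \<open>r\<close> and \<open>j\<close> this is
  \<open>\<langle>\<E>[D\<^sub>kF | \<F>\<^sub>k\<^sub>-\<^sub>1], Y\<^sub>k\<rangle>\<close> (\<open>cond_exp_gradient\<close>). The partial sums of the first series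
  therefore telescope, and they converge because the sets of index tuples with all times below \<open>k\<close> are
  cofinal among the finite subsets of \<open>\<Delta> r\<close> (\<open>L2_sums_martingale_differences\<close>).
  
  For the second series put \<open>G = \<E>[F | \<F>\<^sub>k]\<close>. It has a chaos expansion, namely the truncated one, but the
  gradient is defined through an arbitrary choice of an expansion. Since distinct monomials
  are orthonormal, the kernels of every expansion of \<open>G\<close> vanish at tuples with a time after
  \<open>k\<close> (\<open>kernel_vanishes\<close>). The slices at \<open>k\<close> are then supported strictly before \<open>k\<close>, so that
  \<open>D\<^sub>kG\<close> is itself \<open>\<F>\<^sub>k\<^sub>-\<^sub>1\<close>-measurable and the same computation yields the same increment
  (\<open>gradient_cond_exp\<close>).
  
  Integrability is automatic for functions of finitely many coordinates, since these take finitely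
  many values. The existence of the multiple integrals rests on the completeness of \<open>L\<^sup>2\<close>, along the
  net of finite index sets (\<open>L2_complete_net\<close>), and on the estimate \<open>partial_sum_L2_bound\<close>.
\<close>

section \<open>Square integrable functions\<close>

lemma power2_add_le: "(a + b)\<^sup>2 \<le> 2 * a\<^sup>2 + 2 * (b::real)\<^sup>2"
  using sum_squares_bound[of a b] by (simp add: power2_sum)

lemma L2_D:
  assumes "f \<in> L2 M"
  shows "f \<in> borel_measurable M" "integrable M (\<lambda>x. (f x)\<^sup>2)"
  using assms by (auto simp: L2_def)

lemma L2_mult_integrable:
  assumes "f \<in> L2 M" "g \<in> L2 M"
  shows "integrable M (\<lambda>x. f x * g x)"
proof (rule Bochner_Integration.integrable_bound)
  note [measurable] = L2_D(1)[OF assms(1)] L2_D(1)[OF assms(2)]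
  show "integrable M (\<lambda>x. (f x)\<^sup>2 + (g x)\<^sup>2)"
    using assms[THEN L2_D(2)] by simp
  show "(\<lambda>x. f x * g x) \<in> borel_measurable M" by simp
  have "\<bar>a * b\<bar> \<le> a\<^sup>2 + b\<^sup>2" for a b :: real
    using sum_squares_bound[of a b] sum_squares_bound[of a "-b"] by (auto simp: abs_if)
  then show "AE x in M. norm (f x * g x) \<le> norm ((f x)\<^sup>2 + (g x)\<^sup>2)" by simp
qed

lemma L2_zero: "(\<lambda>_. 0) \<in> L2 M"
  by (simp add: L2_def)

lemma L2_cmult: "f \<in> L2 M \<Longrightarrow> (\<lambda>x. c * f x) \<in> L2 M"
  by (auto simp: L2_def power_mult_distrib)

lemma L2_add:
  assumes "f \<in> L2 M" "g \<in> L2 M"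
  shows "(\<lambda>x. f x + g x) \<in> L2 M"
proof -
  note [measurable] = L2_D(1)[OF assms(1)] L2_D(1)[OF assms(2)]
  show ?thesis
    using assms[THEN L2_D(2)] L2_mult_integrable[OF assms]
    by (auto simp: L2_def power2_sum mult.assoc)
qed

lemma L2_diff: "f \<in> L2 M \<Longrightarrow> g \<in> L2 M \<Longrightarrow> (\<lambda>x. f x - g x) \<in> L2 M"
  using L2_add[of f M "\<lambda>x. - 1 * g x"] L2_cmult[of g M "-1"] by simp

lemma L2_sum: "(\<And>i. i \<in> I \<Longrightarrow> f i \<in> L2 M) \<Longrightarrow> (\<lambda>x. \<Sum>i\<in>I. f i x) \<in> L2 M"
  by (induction I rule: infinite_finite_induct) (auto intro: L2_zero L2_add)

lemma L2_mult_bounded: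
  assumes "f \<in> L2 M" "g \<in> borel_measurable M" "\<And>x. x \<in> space M \<Longrightarrow> \<bar>g x\<bar> \<le> C"
  shows "(\<lambda>x. f x * g x) \<in> L2 M"
proof -
  note [measurable] = L2_D(1)[OF assms(1)] assms(2)
  have "integrable M (\<lambda>x. (f x * g x)\<^sup>2)"
  proof (rule Bochner_Integration.integrable_bound)
    show "integrable M (\<lambda>x. C\<^sup>2 * (f x)\<^sup>2)" using L2_D(2)[OF assms(1)] by simp
    have "(f x)\<^sup>2 * (g x)\<^sup>2 \<le> C\<^sup>2 * (f x)\<^sup>2" if "x \<in> space M" for x
      using mult_right_mono[OF power_mono[OF assms(3)[OF that], of 2], of "(f x)\<^sup>2"]
      by (simp add: mult.commute)
    then show "AE x in M. norm ((f x * g x)\<^sup>2) \<le> norm (C\<^sup>2 * (f x)\<^sup>2)"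
      by (intro AE_I2) (simp add: power_mult_distrib)
  qed simp
  then show ?thesis by (simp add: L2_def)
qed

lemma L2_cong_AE:
  assumes "f \<in> L2 M" "g \<in> borel_measurable M" "AE x in M. g x = f x"
  shows "g \<in> L2 M"
proof -
  note [measurable] = L2_D(1)[OF assms(1)] assms(2)
  have "integrable M (\<lambda>x. (f x)\<^sup>2) \<longleftrightarrow> integrable M (\<lambda>x. (g x)\<^sup>2)"
    by (rule integrable_cong_AE) (use assms(3) in auto)
  then show ?thesis using assms L2_D(2)[OF assms(1)] by (simp add: L2_def)
qed

lemma L2_tendsto_unique:
  assumes "L2_tendsto M s G \<A>" "L2_tendsto M s H \<A>" "\<A> \<noteq> bot"
  shows "AE x in M. G x = H x"
proof -
  have GH: "G \<in> L2 M" "H \<in> L2 M" using assms by (auto simp: L2_tendsto_def)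
  note [measurable] = L2_D(1)[OF GH(1)] L2_D(1)[OF GH(2)]
  have "((\<lambda>b. 2 * (\<integral>x. (s b x - G x)\<^sup>2 \<partial>M) + 2 * (\<integral>x. (s b x - H x)\<^sup>2 \<partial>M)) \<longlongrightarrow> 2 * 0 + 2 * 0) \<A>"
    using assms by (intro tendsto_intros) (auto simp: L2_tendsto_def)
  moreover have "\<forall>\<^sub>F b in \<A>. (\<integral>x. (G x - H x)\<^sup>2 \<partial>M)
      \<le> 2 * (\<integral>x. (s b x - G x)\<^sup>2 \<partial>M) + 2 * (\<integral>x. (s b x - H x)\<^sup>2 \<partial>M)"
  proof -
    have "\<forall>\<^sub>F b in \<A>. s b \<in> L2 M" using assms by (simp add: L2_tendsto_def)
    then show ?thesis
    proof eventually_elim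
      case (elim b)
      note i = L2_D(2)[OF L2_diff[OF elim GH(1)]] L2_D(2)[OF L2_diff[OF elim GH(2)]]
      have "(\<integral>x. (G x - H x)\<^sup>2 \<partial>M) \<le> (\<integral>x. 2 * (s b x - G x)\<^sup>2 + 2 * (s b x - H x)\<^sup>2 \<partial>M)"
      proof (rule integral_mono)
        show "(G x - H x)\<^sup>2 \<le> 2 * (s b x - G x)\<^sup>2 + 2 * (s b x - H x)\<^sup>2" for x
          using power2_add_le[of "G x - s b x" "s b x - H x"] by (simp add: power2_commute[of "G x"])
      qed (use i L2_D(2)[OF L2_diff[OF GH]] in auto)
      then show ?case using i by simp
    qed
  qed
  ultimately have "(\<integral>x. (G x - H x)\<^sup>2 \<partial>M) \<le> 0"
    using tendsto_lowerbound assms(3) by fastforce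
  moreover have "(\<integral>x. (G x - H x)\<^sup>2 \<partial>M) \<ge> 0" by simp
  ultimately have "(\<integral>x. (G x - H x)\<^sup>2 \<partial>M) = 0" by linarith
  then have "AE x in M. (G x - H x)\<^sup>2 = 0"
    using integral_nonneg_eq_0_iff_AE[OF L2_D(2)[OF L2_diff[OF GH]]] by simp
  then show ?thesis by simp
qed

lemma L2_tendsto_add:
  assumes "L2_tendsto M s G \<A>" "L2_tendsto M t H \<A>"
  shows "L2_tendsto M (\<lambda>b x. s b x + t b x) (\<lambda>x. G x + H x) \<A>"
proof -
  have GH: "G \<in> L2 M" "H \<in> L2 M" using assms by (auto simp: L2_tendsto_def)
  have ev: "\<forall>\<^sub>F b in \<A>. s b \<in> L2 M \<and> t b \<in> L2 M"
    using assms by (simp add: L2_tendsto_def eventually_conj)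
  have lim: "((\<lambda>b. 2 * (\<integral>x. (s b x - G x)\<^sup>2 \<partial>M) + 2 * (\<integral>x. (t b x - H x)\<^sup>2 \<partial>M)) \<longlongrightarrow> 2 * 0 + 2 * 0) \<A>"
    using assms by (intro tendsto_intros) (auto simp: L2_tendsto_def)
  have "((\<lambda>b. \<integral>x. (s b x + t b x - (G x + H x))\<^sup>2 \<partial>M) \<longlongrightarrow> 0) \<A>"
  proof (rule tendsto_sandwich[OF _ _ tendsto_const lim[simplified]])
    show "\<forall>\<^sub>F b in \<A>. (\<integral>x. (s b x + t b x - (G x + H x))\<^sup>2 \<partial>M)
        \<le> 2 * (\<integral>x. (s b x - G x)\<^sup>2 \<partial>M) + 2 * (\<integral>x. (t b x - H x)\<^sup>2 \<partial>M)"
      using ev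
    proof eventually_elim
      case (elim b)
      then have b: "s b \<in> L2 M" "t b \<in> L2 M" by auto
      note i = L2_D(2)[OF L2_diff[OF b(1) GH(1)]] L2_D(2)[OF L2_diff[OF b(2) GH(2)]]
      have "(\<integral>x. (s b x + t b x - (G x + H x))\<^sup>2 \<partial>M)
          \<le> (\<integral>x. 2 * (s b x - G x)\<^sup>2 + 2 * (t b x - H x)\<^sup>2 \<partial>M)"
      proof (rule integral_mono)
        show "(s b x + t b x - (G x + H x))\<^sup>2 \<le> 2 * (s b x - G x)\<^sup>2 + 2 * (t b x - H x)\<^sup>2" for x
          using power2_add_le[of "s b x - G x" "t b x - H x"] by (simp add: algebra_simps)
      qed (use i L2_D(2)[OF L2_diff[OF L2_add[OF b] L2_add[OF GH]]] in auto)
      then show ?case using i by simp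
    qed
  qed simp
  then show ?thesis
    using L2_add[OF GH] ev L2_add unfolding L2_tendsto_def by (auto elim!: eventually_mono)
qed

lemma L2_tendsto_sum:
  assumes "\<And>i. i \<in> I \<Longrightarrow> L2_tendsto M (s i) (G i) \<A>"
  shows "L2_tendsto M (\<lambda>b x. \<Sum>i\<in>I. s i b x) (\<lambda>x. \<Sum>i\<in>I. G i x) \<A>"
  using assms
proof (induction I rule: infinite_finite_induct)
  case (insert i I)
  then show ?case using L2_tendsto_add[of M "s i" "G i" \<A>] by simp
qed (auto simp: L2_tendsto_def L2_zero)

lemma L2_tendsto_const: "G \<in> L2 M \<Longrightarrow> L2_tendsto M (\<lambda>_. G) G \<A>"
  by (simp add: L2_tendsto_def)

lemma L2_tendsto_filterlim:
  "L2_tendsto M s G \<A> \<Longrightarrow> filterlim h \<A> \<B> \<Longrightarrow> L2_tendsto M (\<lambda>b. s (h b)) G \<B>"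
  unfolding L2_tendsto_def using filterlim_compose eventually_compose_filterlim by blast

lemma L2_tendsto_cong_AE:
  assumes "L2_tendsto M s G \<A>" "\<forall>\<^sub>F b in \<A>. t b \<in> borel_measurable M \<and> (AE x in M. t b x = s b x)"
    and "H \<in> borel_measurable M" "AE x in M. H x = G x"
  shows "L2_tendsto M t H \<A>"
proof -
  have G: "G \<in> L2 M" using assms by (auto simp: L2_tendsto_def)
  have "\<forall>\<^sub>F b in \<A>. s b \<in> L2 M" using assms by (auto simp: L2_tendsto_def)
  with assms(2) have ev: "\<forall>\<^sub>F b in \<A>. t b \<in> L2 M \<and>
      (\<integral>x. (s b x - G x)\<^sup>2 \<partial>M) = (\<integral>x. (t b x - H x)\<^sup>2 \<partial>M)"
  proof eventually_elim
    case (elim b)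
    note [measurable] = L2_D(1)[OF G] L2_D(1)[OF elim(2)] conjunct1[OF elim(1)] assms(3)
    have "(\<integral>x. (s b x - G x)\<^sup>2 \<partial>M) = (\<integral>x. (t b x - H x)\<^sup>2 \<partial>M)"
      using assms(4) elim(1) by (intro integral_cong_AE) auto
    then show ?case using L2_cong_AE[OF elim(2)] elim(1) by auto
  qed
  have "((\<lambda>b. \<integral>x. (t b x - H x)\<^sup>2 \<partial>M) \<longlongrightarrow> 0) \<A>"
    by (rule Lim_transform_eventually[of "\<lambda>b. \<integral>x. (s b x - G x)\<^sup>2 \<partial>M"])
      (use ev assms(1) in \<open>auto simp: L2_tendsto_def elim!: eventually_mono\<close>)
  then show ?thesis
    using L2_cong_AE[OF G assms(3,4)] ev unfolding L2_tendsto_def by (auto elim!: eventually_mono)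
qed

context prob_space
begin

lemma L2_integrable: "f \<in> L2 M \<Longrightarrow> integrable M f"
  using L2_mult_integrable[of f M "\<lambda>_. 1"] by (simp add: L2_def)

lemma L2_bounded:
  assumes "f \<in> borel_measurable M" "\<And>x. x \<in> space M \<Longrightarrow> \<bar>f x\<bar> \<le> C"
  shows "f \<in> L2 M"
  using L2_mult_bounded[of "\<lambda>_. 1" M f C] assms by (simp add: L2_def)

lemma L2_const: "(\<lambda>_. c) \<in> L2 M"
  by (simp add: L2_def)

text \<open>
  The increments have summable \<open>L\<^sup>1\<close> norms, so their sum converges absolutely at almost every point.
\<close>

lemma L2_Cauchy_sequence_AE_convergent:
  fixes g :: "nat \<Rightarrow> 'a \<Rightarrow> real"
  assumes g: "\<And>n. g n \<in> L2 M"
    and step: "\<And>n. (\<integral>x. (g (Suc n) x - g n x)\<^sup>2 \<partial>M) \<le> (1/4)^n"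
  shows "AE x in M. convergent (\<lambda>n. g n x)"
proof -
  define h where "h n x = g (Suc n) x - g n x" for n x
  have hL: "h n \<in> L2 M" for n using L2_diff[OF g g] by (simp add: h_def[abs_def])
  note [measurable] = L2_D(1)[OF hL]
  have hI: "(\<integral>x. \<bar>h n x\<bar> \<partial>M) \<le> (1/2)^n" for n
  proof -
    \<comment> \<open>the arithmetic-geometric mean inequality with the weight \<open>2\<^sup>n\<close>\<close>
    have "\<bar>h n x\<bar> \<le> ((1/2)^n + 2^n * (h n x)\<^sup>2) / 2" for x
    proof -
      have "0 \<le> (1 - 2^n * \<bar>h n x\<bar>)\<^sup>2" by simp
      also have "\<dots> = 1 - 2 * 2^n * \<bar>h n x\<bar> + (2^n)\<^sup>2 * (h n x)\<^sup>2"
        by (simp add: power2_diff power_mult_distrib)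
      finally have "2 * 2^n * \<bar>h n x\<bar> \<le> 1 + (2^n)\<^sup>2 * (h n x)\<^sup>2" by simp
      then show ?thesis by (simp add: field_simps power2_eq_square)
    qed
    then have "(\<integral>x. \<bar>h n x\<bar> \<partial>M) \<le> (\<integral>x. ((1/2)^n + 2^n * (h n x)\<^sup>2) / 2 \<partial>M)"
      using hL by (intro integral_mono) (auto simp: L2_integrable L2_D)
    also have "\<dots> = ((1/2)^n + 2^n * (\<integral>x. (h n x)\<^sup>2 \<partial>M)) / 2"
      using L2_D(2)[OF hL] by (simp add: prob_space)
    also have "\<dots> \<le> ((1/2)^n + 2^n * (1/4)^n) / 2"
      using step[of n] by (intro divide_right_mono add_left_mono mult_left_mono) (auto simp: h_def)
    also have "2^n * (1/4)^n = (1/2::real)^n" by (simp flip: power_mult_distrib)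
    finally show ?thesis by simp
  qed
  have "(\<integral>\<^sup>+x. (\<Sum>n. ennreal \<bar>h n x\<bar>) \<partial>M) = (\<Sum>n. \<integral>\<^sup>+x. ennreal \<bar>h n x\<bar> \<partial>M)"
    by (rule nn_integral_suminf) simp
  also have "\<dots> \<le> (\<Sum>n. ennreal ((1/2)^n))"
    using hI hL by (intro suminf_le) (auto simp: nn_integral_eq_integral L2_integrable)
  also have "(\<Sum>n. ennreal ((1/2)^n)) = ennreal 2"
    by (rule suminf_ennreal_eq) (use geometric_sums[of "1/2::real"] in auto)
  finally have bound: "(\<integral>\<^sup>+x. (\<Sum>n. ennreal \<bar>h n x\<bar>) \<partial>M) \<le> ennreal 2" .
  have "(\<integral>\<^sup>+x. (\<Sum>n. ennreal \<bar>h n x\<bar>) \<partial>M) \<noteq> \<infinity>"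
    using order.strict_trans1[OF bound ennreal_less_top] by (simp only: infinity_ennreal_def less_top)
  then have "AE x in M. (\<Sum>n. ennreal \<bar>h n x\<bar>) \<noteq> \<infinity>"
    by (rule nn_integral_PInf_AE[rotated]) simp
  then show ?thesis
  proof eventually_elim
    case (elim x)
    then have "summable (\<lambda>n. \<bar>h n x\<bar>)" by (intro summable_suminf_not_top) auto
    then have "summable (\<lambda>n. h n x)" by (rule summable_rabs_cancel)
    then have "(\<lambda>n. g 0 x + (\<Sum>i<n. h i x)) \<longlonglongrightarrow> g 0 x + (\<Sum>i. h i x)"
      by (intro tendsto_intros summable_LIMSEQ)
    moreover have "g 0 x + (\<Sum>i<n. h i x) = g n x" for n
      using sum_lessThan_telescope[of "\<lambda>n. g n x" n] by (simp add: h_def)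
    ultimately show ?case by (auto simp: convergent_def)
  qed
qed

text \<open>
  The Cauchy property provides an increasing sequence of finite sets along which the pointwise limit
  exists. Fatou's lemma bounds the distance to this limit, and the Cauchy property transfers the
  bound from the sequence to the whole net.
\<close>

lemma L2_complete_net:
  assumes s: "\<And>A. finite A \<Longrightarrow> A \<subseteq> X \<Longrightarrow> s A \<in> L2 M"
    and Cauchy: "\<And>e. e > 0 \<Longrightarrow> \<exists>A. finite A \<and> A \<subseteq> X \<and>
      (\<forall>B. finite B \<longrightarrow> A \<subseteq> B \<longrightarrow> B \<subseteq> X \<longrightarrow> (\<integral>x. (s B x - s A x)\<^sup>2 \<partial>M) \<le> e)"
  shows "\<exists>G. L2_tendsto M s G (finite_subsets_at_top X)"
proof -
  have "\<forall>n::nat. \<exists>A. finite A \<and> A \<subseteq> X \<and>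
      (\<forall>B. finite B \<longrightarrow> A \<subseteq> B \<longrightarrow> B \<subseteq> X \<longrightarrow> (\<integral>x. (s B x - s A x)\<^sup>2 \<partial>M) \<le> (1/4)^n / 4)"
    by (intro allI Cauchy) simp
  from choice[OF this] obtain A0 where "\<forall>n. finite (A0 n) \<and> A0 n \<subseteq> X \<and>
      (\<forall>B. finite B \<longrightarrow> A0 n \<subseteq> B \<longrightarrow> B \<subseteq> X \<longrightarrow> (\<integral>x. (s B x - s (A0 n) x)\<^sup>2 \<partial>M) \<le> (1/4)^n / 4)" ..
  then have A0: "\<And>n. finite (A0 n)" "\<And>n. A0 n \<subseteq> X"
      "\<And>n B. finite B \<Longrightarrow> A0 n \<subseteq> B \<Longrightarrow> B \<subseteq> X \<Longrightarrow> (\<integral>x. (s B x - s (A0 n) x)\<^sup>2 \<partial>M) \<le> (1/4)^n / 4"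
    by simp_all
  \<comment> \<open>the sets \<open>A0 n\<close> need not increase; the factor \<open>4\<close> pays for passing to their unions\<close>
  define A where "A n = (\<Union>i\<le>n. A0 i)" for n
  have A: "finite (A n)" "A n \<subseteq> X" "A0 n \<subseteq> A n" for n using A0 by (auto simp: A_def)
  have A_mono: "A n \<subseteq> A m" if "n \<le> m" for n m unfolding A_def using that by (intro UN_mono) auto
  have dist: "(\<integral>x. (s B x - s (A n) x)\<^sup>2 \<partial>M) \<le> (1/4)^n"
    if "finite B" "A n \<subseteq> B" "B \<subseteq> X" for n B
  proof -
    have L: "s B \<in> L2 M" "s (A n) \<in> L2 M" "s (A0 n) \<in> L2 M" using s that A A0 by auto
    have "(\<integral>x. (s B x - s (A n) x)\<^sup>2 \<partial>M)
        \<le> (\<integral>x. 2 * (s B x - s (A0 n) x)\<^sup>2 + 2 * (s (A n) x - s (A0 n) x)\<^sup>2 \<partial>M)"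
    proof (rule integral_mono)
      show "(s B x - s (A n) x)\<^sup>2 \<le> 2 * (s B x - s (A0 n) x)\<^sup>2 + 2 * (s (A n) x - s (A0 n) x)\<^sup>2" for x
        using power2_add_le[of "s B x - s (A0 n) x" "s (A0 n) x - s (A n) x"]
        by (simp add: power2_commute[of "s (A0 n) x"])
    qed (use L2_D(2)[OF L2_diff[OF L(1,2)]] L2_D(2)[OF L2_diff[OF L(1,3)]]
        L2_D(2)[OF L2_diff[OF L(2,3)]] in auto)
    also have "\<dots> = 2 * (\<integral>x. (s B x - s (A0 n) x)\<^sup>2 \<partial>M) + 2 * (\<integral>x. (s (A n) x - s (A0 n) x)\<^sup>2 \<partial>M)"
      using L2_D(2)[OF L2_diff[OF L(1,3)]] L2_D(2)[OF L2_diff[OF L(2,3)]] by simp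
    also have "\<dots> \<le> 2 * ((1/4)^n / 4) + 2 * ((1/4)^n / 4)"
      using that A[of n] by (intro add_mono mult_left_mono A0(3)) auto
    finally show ?thesis by simp
  qed
  define g where "g n = s (A n)" for n
  have g: "g n \<in> L2 M" for n using s A by (auto simp: g_def)
  note [measurable] = L2_D(1)[OF g]
  have conv: "AE x in M. convergent (\<lambda>n. g n x)"
    by (rule L2_Cauchy_sequence_AE_convergent[OF g])
      (simp add: g_def dist[OF A(1) A_mono A(2)])
  define G where "G x = lim (\<lambda>n. g n x)" for x
  have Gm [measurable]: "G \<in> borel_measurable M" unfolding G_def by measurable
  have fatou: "(\<integral>\<^sup>+x. ennreal ((g n x - G x)\<^sup>2) \<partial>M) \<le> ennreal ((1/4)^n)" for n
  proof -
    have "(\<integral>\<^sup>+x. ennreal ((g n x - G x)\<^sup>2) \<partial>M) = (\<integral>\<^sup>+x. liminf (\<lambda>m. ennreal ((g n x - g m x)\<^sup>2)) \<partial>M)"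
    proof (rule nn_integral_cong_AE)
      show "AE x in M. ennreal ((g n x - G x)\<^sup>2) = liminf (\<lambda>m. ennreal ((g n x - g m x)\<^sup>2))"
        using conv
      proof eventually_elim
        case (elim x)
        then have "(\<lambda>m. g m x) \<longlonglongrightarrow> G x" by (simp add: G_def convergent_LIMSEQ_iff)
        then have "(\<lambda>m. ennreal ((g n x - g m x)\<^sup>2)) \<longlonglongrightarrow> ennreal ((g n x - G x)\<^sup>2)"
          by (intro tendsto_intros)
        then show ?case by (intro lim_imp_Liminf[symmetric]) auto
      qed
    qed
    also have "\<dots> \<le> liminf (\<lambda>m. \<integral>\<^sup>+x. ennreal ((g n x - g m x)\<^sup>2) \<partial>M)"
      by (rule nn_integral_liminf) simp
    also have "\<dots> \<le> ennreal ((1/4)^n)"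
    proof (rule Liminf_le)
      show "\<forall>\<^sub>F m in sequentially. (\<integral>\<^sup>+x. ennreal ((g n x - g m x)\<^sup>2) \<partial>M) \<le> ennreal ((1/4)^n)"
        using eventually_ge_at_top[of n]
      proof eventually_elim
        case (elim m)
        have "(\<integral>\<^sup>+x. ennreal ((g n x - g m x)\<^sup>2) \<partial>M) = ennreal (\<integral>x. (g m x - g n x)\<^sup>2 \<partial>M)"
          using L2_D(2)[OF L2_diff[OF g g]]
          by (subst power2_commute) (rule nn_integral_eq_integral; simp)
        also have "\<dots> \<le> ennreal ((1/4)^n)"
          using dist[OF A(1) A_mono[OF elim] A(2)] by (simp add: g_def ennreal_leI)
        finally show ?case .
      qed
    qed simp
    finally show ?thesis .
  qed
  have gG: "(\<lambda>x. g n x - G x) \<in> L2 M" for n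
    unfolding L2_def using fatou[of n]
    by (auto simp: integrable_iff_bounded intro: order.strict_trans1)
  have GL: "G \<in> L2 M" using L2_diff[OF g[of 0] gG[of 0]] by simp
  have gGi: "(\<integral>x. (g n x - G x)\<^sup>2 \<partial>M) \<le> (1/4)^n" for n
    using fatou[of n] L2_D(2)[OF gG[of n]] by (simp add: nn_integral_eq_integral)
  have "((\<lambda>B. \<integral>x. (s B x - G x)\<^sup>2 \<partial>M) \<longlongrightarrow> 0) (finite_subsets_at_top X)"
  proof (rule tendstoI)
    fix e :: real assume "e > 0"
    have "(\<lambda>n. (1/4)^n :: real) \<longlonglongrightarrow> 0" by (rule LIMSEQ_power_zero) simp
    then have "\<forall>\<^sub>F n in sequentially. (1/4)^n < e / 4"
      using \<open>e > 0\<close> by (intro order_tendstoD) auto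
    then obtain n where n: "(1/4)^n < e / 4" by (auto dest: eventually_happens)
    show "\<forall>\<^sub>F B in finite_subsets_at_top X. Real_Vector_Spaces.dist (\<integral>x. (s B x - G x)\<^sup>2 \<partial>M) 0 < e"
      unfolding eventually_finite_subsets_at_top
    proof (intro exI[of _ "A n"] conjI allI impI)
      fix B assume "finite B \<and> A n \<subseteq> B \<and> B \<subseteq> X"
      then have B: "finite B" "A n \<subseteq> B" "B \<subseteq> X" by auto
      have L: "s B \<in> L2 M" using s B by auto
      have "(\<integral>x. (s B x - G x)\<^sup>2 \<partial>M) \<le> (\<integral>x. 2 * (s B x - g n x)\<^sup>2 + 2 * (g n x - G x)\<^sup>2 \<partial>M)"
      proof (rule integral_mono)
        show "(s B x - G x)\<^sup>2 \<le> 2 * (s B x - g n x)\<^sup>2 + 2 * (g n x - G x)\<^sup>2" for x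
          using power2_add_le[of "s B x - g n x" "g n x - G x"] by simp
      qed (use L2_D(2)[OF L2_diff[OF L GL]] L2_D(2)[OF L2_diff[OF L g]] L2_D(2)[OF gG] in auto)
      also have "\<dots> = 2 * (\<integral>x. (s B x - g n x)\<^sup>2 \<partial>M) + 2 * (\<integral>x. (g n x - G x)\<^sup>2 \<partial>M)"
        using L2_D(2)[OF L2_diff[OF L g]] L2_D(2)[OF gG] by simp
      also have "\<dots> \<le> 2 * (1/4)^n + 2 * (1/4)^n"
        using dist[OF B] gGi[of n] by (intro add_mono mult_left_mono) (auto simp: g_def)
      also have "\<dots> < e" using n by simp
      finally show "Real_Vector_Spaces.dist (\<integral>x. (s B x - G x)\<^sup>2 \<partial>M) 0 < e" by simp
    qed (use A in auto)
  qed
  moreover have "\<forall>\<^sub>F B in finite_subsets_at_top X. s B \<in> L2 M"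
    by (rule eventually_finite_subsets_at_top_weakI) (rule s)
  ultimately show ?thesis
    using GL unfolding L2_tendsto_def by blast
qed

end

section \<open>The filtration of the walk and products of letters\<close>

lemma space_past [simp]: "space (past P n) = space P"
  by (auto simp: past_def gen_sigma_def space_measure_of_conv)

lemma sets_past:
  "sets (past P n) = sigma_sets (space P) {(\<lambda>\<omega>. \<omega> i) -` A \<inter> space P | i A. i < n}"
  by (auto simp: past_def gen_sigma_def sets_measure_of_conv)

text \<open>
  A set in the \<open>\<sigma>\<close>-field of the first \<open>n\<close> coordinates contains, with a sample point, all sample points
  that agree with it at the first \<open>n\<close> times. So \<open>f\<close> factors through the finitely many initial segments.
\<close>

lemma measurable_past_finite_image:
  fixes f :: "(nat \<Rightarrow> nat) \<Rightarrow> real"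
  assumes coord_le: "\<And>\<omega> i. \<omega> \<in> space P \<Longrightarrow> \<omega> i \<le> d"
    and f: "f \<in> borel_measurable (past P n)"
  shows "finite (f ` space P)"
proof -
  have saturated: "\<omega> \<in> A \<longleftrightarrow> \<omega>' \<in> A"
    if "A \<in> sets (past P n)" "\<omega> \<in> space P" "\<omega>' \<in> space P" "\<And>i. i < n \<Longrightarrow> \<omega> i = \<omega>' i" for A \<omega> \<omega>'
    using that(1)[unfolded sets_past] by (induction rule: sigma_sets.induct) (use that(2,3,4) in auto)
  have f_eq: "f \<omega> = f \<omega>'"
    if "\<omega> \<in> space P" "\<omega>' \<in> space P" "\<And>i. i < n \<Longrightarrow> \<omega> i = \<omega>' i" for \<omega> \<omega>'
    using saturated[OF measurable_sets[OF f, of "{f \<omega>}"] that] that by auto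
  let ?w = "\<lambda>\<omega>::nat \<Rightarrow> nat. restrict \<omega> {..<n}"
  have "?w ` space P \<subseteq> PiE {..<n} (\<lambda>_. {..d})" by (auto simp: coord_le split: if_splits)
  then have fin: "finite (?w ` space P)" by (rule finite_subset) (auto intro: finite_PiE)
  \<comment> \<open>one representative for each initial segment\<close>
  have "f ` space P = (\<lambda>u. f (SOME \<omega>. \<omega> \<in> space P \<and> ?w \<omega> = u)) ` (?w ` space P)"
    unfolding image_image
  proof (rule image_cong[OF refl])
    fix \<omega> assume \<omega>: "\<omega> \<in> space P"
    let ?\<omega> = "SOME \<omega>'. \<omega>' \<in> space P \<and> ?w \<omega>' = ?w \<omega>"
    have "?\<omega> \<in> space P \<and> ?w ?\<omega> = ?w \<omega>" by (rule someI[of _ \<omega>]) (use \<omega> in simp)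
    then have \<omega>': "?\<omega> \<in> space P" "?w ?\<omega> = ?w \<omega>" by auto
    have "\<omega> i = ?\<omega> i" if "i < n" for i
      using fun_cong[OF \<omega>'(2), of i] that by simp
    then show "f \<omega> = f ?\<omega>" by (rule f_eq[OF \<omega> \<omega>'(1)])
  qed
  with fin show ?thesis by simp
qed

context obtuse_random_walk
begin

lemma coordinate_le: "\<omega> \<in> space P \<Longrightarrow> \<omega> i \<le> CARD('d)"
  using sets_eq_imp_space_eq[OF sets_P] by (auto simp: space_PiM)

lemma past_mono: "m \<le> n \<Longrightarrow> subalgebra (past P n) (past P m)"
  unfolding subalgebra_def sets_past space_past
  by (intro conjI refl sigma_sets_mono' Collect_mono) (blast intro: less_le_trans)

lemma subalgebra_past: "subalgebra P (past P n)"
proof -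
  have "(\<lambda>\<omega>. \<omega> i) -` A \<inter> space P \<in> sets P" for i :: nat and A :: "nat set"
  proof -
    have "(\<lambda>\<omega>. \<omega> i) \<in> measurable (PiM UNIV (\<lambda>n::nat. count_space {0..CARD('d)})) (count_space {0..CARD('d)})"
      by (rule measurable_component_singleton) simp
    then have "(\<lambda>\<omega>. \<omega> i) \<in> measurable P (count_space {0..CARD('d)})"
      using measurable_cong_sets[OF sets_P refl] by blast
    then have "(\<lambda>\<omega>. \<omega> i) -` (A \<inter> {0..CARD('d)}) \<inter> space P \<in> sets P"
      by (rule measurable_sets) simp
    moreover have "(\<lambda>\<omega>. \<omega> i) -` (A \<inter> {0..CARD('d)}) \<inter> space P = (\<lambda>\<omega>. \<omega> i) -` A \<inter> space P"
      using coordinate_le by auto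
    ultimately show ?thesis by simp
  qed
  then show ?thesis
    unfolding subalgebra_def by (auto simp: sets_past intro!: sets.sigma_sets_subset)
qed

lemma finite_measure_subalgebra_past: "finite_measure_subalgebra P (past P n)"
  by unfold_locales (rule subalgebra_past)

sublocale past: finite_measure_subalgebra P "past P n" for n
  by (rule finite_measure_subalgebra_past)

lemma measurable_past_mono: "m \<le> n \<Longrightarrow> f \<in> borel_measurable (past P m) \<Longrightarrow> f \<in> borel_measurable (past P n)"
  using measurable_from_subalg[OF past_mono] .

lemma measurable_past: "f \<in> borel_measurable (past P n) \<Longrightarrow> f \<in> borel_measurable P"
  using measurable_from_subalg[OF subalgebra_past] .

lemma measurable_past_bounded:
  fixes f :: "(nat \<Rightarrow> nat) \<Rightarrow> real"
  assumes "f \<in> borel_measurable (past P n)"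
  obtains C where "\<And>\<omega>. \<omega> \<in> space P \<Longrightarrow> \<bar>f \<omega>\<bar> \<le> C"
proof
  have "finite (f ` space P)"
    using coordinate_le assms by (rule measurable_past_finite_image)
  then show "\<bar>f \<omega>\<bar> \<le> Max (abs ` f ` space P)" if "\<omega> \<in> space P" for \<omega>
    using that by (intro Max_ge) auto
qed

lemma measurable_past_L2:
  assumes "f \<in> borel_measurable (past P n)"
  shows "f \<in> L2 P"
  using measurable_past_bounded[OF assms] L2_bounded[OF measurable_past[OF assms]] by blast

lemmas measurable_past_integrable = L2_integrable[OF measurable_past_L2]

lemma L2_mult_past:
  assumes "f \<in> L2 P" "g \<in> borel_measurable (past P n)"
  shows "(\<lambda>\<omega>. f \<omega> * g \<omega>) \<in> L2 P"
  using measurable_past_bounded[OF assms(2)] L2_mult_bounded[OF assms(1) measurable_past[OF assms(2)]] by blast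

text \<open>
  The walk generates the filtration by assumption, so it is adapted to it.
\<close>

lemma walk_measurable: "(\<lambda>\<omega>. walk v n \<omega> $ j) \<in> borel_measurable (past P (Suc n))"
proof -
  have "walk v n \<in> borel_measurable (gen_sigma (space P) {..n} (walk v) borel)"
    unfolding gen_sigma_def
    by (rule measurableI) (auto simp: space_measure_of_conv sets_measure_of_conv intro!: sigma_sets.Basic)
  then have "walk v n \<in> borel_measurable (past P (Suc n))"
    using measurable_cong_sets[OF walk_generates refl] by blast
  then have "(\<lambda>\<omega>. walk v n \<omega> \<bullet> axis j 1) \<in> borel_measurable (past P (Suc n))" by simp
  then show ?thesis by (simp add: cart_eq_inner_axis)
qed

text \<open>
  Factors at times \<open>\<ge> k\<close> with constant conditional mean integrate out one at a time, latest first,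
  by the tower property.
\<close>

lemma cond_exp_product:
  assumes g: "\<And>i. g i \<in> borel_measurable (past P (Suc i))"
    and c: "\<And>i. AE \<omega> in P. real_cond_exp P (past P i) (g i) \<omega> = c i"
    and "k \<le> N"
  shows "AE \<omega> in P. real_cond_exp P (past P k) (\<lambda>\<omega>. \<Prod>i<N. g i \<omega>) \<omega>
    = (\<Prod>i<k. g i \<omega>) * (\<Prod>i\<in>{k..<N}. c i)"
  using \<open>k \<le> N\<close>
proof (induction N rule: dec_induct)
  case base
  have "(\<lambda>\<omega>. \<Prod>i<k. g i \<omega>) \<in> borel_measurable (past P k)"
    by (intro borel_measurable_prod measurable_past_mono[OF _ g]) auto
  then show ?case using past.real_cond_exp_F_meas[OF measurable_past_integrable] by auto
next
  case (step N)
  let ?E = "\<lambda>k. real_cond_exp P (past P k)"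
  have m: "(\<lambda>\<omega>. \<Prod>i<N. g i \<omega>) \<in> borel_measurable (past P N)" for N
    by (intro borel_measurable_prod measurable_past_mono[OF _ g]) auto
  note i = measurable_past_integrable[OF m]
  have "AE \<omega> in P. ?E k (?E N (\<lambda>\<omega>. \<Prod>i<Suc N. g i \<omega>)) \<omega> = ?E k (\<lambda>\<omega>. \<Prod>i<Suc N. g i \<omega>) \<omega>"
    by (rule past.real_cond_exp_nested_subalg[OF subalgebra_past past_mono i]) (use step in simp)
  moreover have "AE \<omega> in P. ?E N (\<lambda>\<omega>. \<Prod>i<Suc N. g i \<omega>) \<omega> = (\<Prod>i<N. g i \<omega>) * ?E N (g N) \<omega>"
    using past.real_cond_exp_mult[OF m measurable_past[OF g], of N N] i[of "Suc N"]
    by (simp add: mult.commute)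
  then have "AE \<omega> in P. ?E N (\<lambda>\<omega>. \<Prod>i<Suc N. g i \<omega>) \<omega> = c N * (\<Prod>i<N. g i \<omega>)"
    using c[of N] by eventually_elim simp
  then have "AE \<omega> in P. ?E k (?E N (\<lambda>\<omega>. \<Prod>i<Suc N. g i \<omega>)) \<omega> = ?E k (\<lambda>\<omega>. c N * (\<Prod>i<N. g i \<omega>)) \<omega>"
    using measurable_past[OF m] by (intro past.real_cond_exp_cong) auto
  moreover have "AE \<omega> in P. ?E k (\<lambda>\<omega>. c N * (\<Prod>i<N. g i \<omega>)) \<omega> = c N * ?E k (\<lambda>\<omega>. \<Prod>i<N. g i \<omega>) \<omega>"
    by (rule past.real_cond_exp_cmult[OF i])
  ultimately show ?case using step.IH
    by eventually_elim (use step.hyps in \<open>simp add: prod.atLeastLessThan_Suc\<close>)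
qed

lemma cond_exp_zero:
  assumes "integrable P f"
  shows "AE \<omega> in P. real_cond_exp P (past P 0) f \<omega> = expectation f"
proof (rule past.real_cond_exp_charact)
  fix A assume "A \<in> sets (past P 0)"
  then have "A = {} \<or> A = space P"
    unfolding sets_past
  proof (induction rule: sigma_sets.induct)
    case (Union a)
    then show ?case by (cases "\<exists>i. a i = space P") blast+
  qed auto
  then show "(\<integral>x\<in>A. f x \<partial>P) = (\<integral>x\<in>A. expectation f \<partial>P)"
    using assms set_integral_space[of P f]
    by (auto simp: set_lebesgue_integral_def prob_space)
qed (use assms in auto)

lemma expectation_product:
  assumes g: "\<And>i. g i \<in> borel_measurable (past P (Suc i))"
    and c: "\<And>i. AE \<omega> in P. real_cond_exp P (past P i) (g i) \<omega> = c i"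
  shows "expectation (\<lambda>\<omega>. \<Prod>i<N. g i \<omega>) = (\<Prod>i<N. c i)"
proof -
  have m: "(\<lambda>\<omega>. \<Prod>i<N. g i \<omega>) \<in> borel_measurable (past P N)"
    by (intro borel_measurable_prod measurable_past_mono[OF _ g]) auto
  have "AE \<omega> in P. expectation (\<lambda>\<omega>. \<Prod>i<N. g i \<omega>) = (\<Prod>i<N. c i)"
    using cond_exp_zero[OF measurable_past_integrable[OF m]] cond_exp_product[of g c 0 N, OF g c le0]
    by eventually_elim (simp add: atLeast0LessThan)
  then show ?thesis by simp
qed

text \<open>
  A word is a product with one letter for each time, where the letter \<open>None\<close> stands for the factor \<open>1\<close>.
  A monomial in the walk at distinct times is a word, whatever the order of its factors, and two words
  multiply time by time. This reduces orthonormality to a statement about single letters.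
\<close>

definition letter :: "'d option \<Rightarrow> nat \<Rightarrow> (nat \<Rightarrow> nat) \<Rightarrow> real" where
  "letter a n \<omega> = (case a of None \<Rightarrow> 1 | Some j \<Rightarrow> walk v n \<omega> $ j)"

definition word :: "(nat \<Rightarrow> 'd option) \<Rightarrow> nat \<Rightarrow> (nat \<Rightarrow> nat) \<Rightarrow> real" where
  "word a N \<omega> = (\<Prod>i<N. letter (a i) i \<omega>)"

lemma letter_measurable: "letter a n \<in> borel_measurable (past P (Suc n))"
  using walk_measurable by (cases a) (auto simp: letter_def[abs_def])

lemma cond_exp_const: "AE \<omega> in P. real_cond_exp P (past P n) (\<lambda>_. c) \<omega> = c"
  by (rule past.real_cond_exp_F_meas) auto

lemma cond_exp_letter: "AE \<omega> in P. real_cond_exp P (past P n) (letter a n) \<omega> = of_bool (a = None)"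
  using cond_exp_const[of n 1] walk_centered by (cases a) (auto simp: letter_def[abs_def])

lemma cond_exp_letter_mult:
  "AE \<omega> in P. real_cond_exp P (past P n) (\<lambda>\<omega>. letter a n \<omega> * letter b n \<omega>) \<omega> = of_bool (a = b)"
  using cond_exp_const[of n 1] walk_centered[of n] walk_orthonormal[of n]
  by (cases a; cases b) (auto simp: letter_def[abs_def] of_bool_def)

lemma cond_exp_word:
  assumes "k \<le> N"
  shows "AE \<omega> in P. real_cond_exp P (past P k) (word a N) \<omega>
    = of_bool (\<forall>i\<in>{k..<N}. a i = None) * word a k \<omega>"
proof -
  have "(\<Prod>i\<in>{k..<N}. of_bool (a i = None)) = (of_bool (\<forall>i\<in>{k..<N}. a i = None) :: real)"
    by (simp add: of_bool_def)
  then show ?thesis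
    using cond_exp_product[of "\<lambda>i. letter (a i) i", OF letter_measurable cond_exp_letter assms]
    by (simp add: word_def[abs_def] mult.commute)
qed

text \<open>
  The product of two words is a product of adapted factors, whose conditional means \<open>0\<close> or \<open>1\<close> are
  given by the centering and orthonormality of the walk at each single time.
\<close>

lemma expectation_word_mult:
  "expectation (\<lambda>\<omega>. word a N \<omega> * word b N \<omega>) = of_bool (\<forall>i<N. a i = b i)"
proof -
  have "expectation (\<lambda>\<omega>. word a N \<omega> * word b N \<omega>) = (\<Prod>i<N. of_bool (a i = b i))"
    unfolding word_def prod.distrib[symmetric]
    by (rule expectation_product[OF borel_measurable_times[OF letter_measurable letter_measurable] cond_exp_letter_mult])
  also have "\<dots> = of_bool (\<forall>i<N. a i = b i)"
    by (auto simp add: of_bool_def)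
  finally show ?thesis .
qed

end

section \<open>Monomials and multiple integrals\<close>

abbreviation square_summable :: "nat \<Rightarrow> ('d::finite list \<Rightarrow> nat list \<Rightarrow> real) \<Rightarrow> bool" where
  "square_summable r f \<equiv> (\<lambda>is. \<Sum>ks\<in>multi_indices r. (f ks is)\<^sup>2) summable_on \<Delta> r"

lemma finite_multi_indices: "finite (multi_indices r :: 'd::finite list set)"
  using finite_lists_length_eq[of "UNIV :: 'd set" r] by (simp add: multi_indices_def)

text \<open>
  At distinct times, a pair of lists is determined up to a simultaneous permutation by the partial
  function that sends each time to its component; symmetric kernels and monomials depend on nothing else.
\<close>

lemma map_of_zip_eq_iff:
  assumes "length is = length ks" "length is' = length ks'" "distinct is" "distinct is'"
  shows "map_of (zip is ks) = map_of (zip is' ks') \<longleftrightarrow> mset (zip is ks) = mset (zip is' ks')"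
proof
  have d: "distinct (zip is ks)" "distinct (zip is' ks')"
    using assms by (auto intro: distinct_zipI1)
  have i: "map_of (zip is ks) i = Some k \<longleftrightarrow> (i, k) \<in> set (zip is ks)"
      "map_of (zip is' ks') i = Some k \<longleftrightarrow> (i, k) \<in> set (zip is' ks')" for i k
    using assms by (auto intro!: map_of_eq_Some_iff)
  {
    assume "map_of (zip is ks) = map_of (zip is' ks')"
    then have "set (zip is ks) = set (zip is' ks')"
      using i by auto
    then show "mset (zip is ks) = mset (zip is' ks')"
      using set_eq_iff_mset_eq_distinct d by blast
  }
  assume "mset (zip is ks) = mset (zip is' ks')"
  then have "set (zip is ks) = set (zip is' ks')" by (rule mset_eq_setD)
  then show "map_of (zip is ks) = map_of (zip is' ks')"
    using i by (intro ext option.expand) (metis not_None_eq option.sel option.collapse)+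
qed

lemma symmetric_kernel_eq:
  assumes f: "symmetric_kernel r f"
    and mem: "ks \<in> multi_indices r" "is \<in> \<Delta> r" "ks' \<in> multi_indices r" "is' \<in> \<Delta> r"
    and eq: "map_of (zip is ks) = map_of (zip is' ks')"
  shows "f ks is = f ks' is'"
proof -
  have len: "length is = r" "length is' = r" "length ks = r" "length ks' = r"
    using mem by (auto simp: multi_indices_def \<Delta>_def)
  have "mset (zip is ks) = mset (zip is' ks')"
    using map_of_zip_eq_iff[of "is" ks is' ks'] eq len mem by (auto simp: \<Delta>_def)
  then obtain p where p: "p permutes {..<length (zip is' ks')}" "permute_list p (zip is' ks') = zip is ks"
    by (rule mset_eq_permutation)
  have "zip (permute_list p is') (permute_list p ks') = zip is ks"
    using p len by (subst permute_list_zip[symmetric, where A = "{..<r}"]) auto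
  then have "permute_list p is' = is \<and> permute_list p ks' = ks"
    using len by (metis length_permute_list map_fst_zip map_snd_zip)
  then show ?thesis
    using f p len mem by (auto simp: symmetric_kernel_def)
qed

context obtuse_random_walk
begin

text \<open>
  The product runs over the length of \<open>ks\<close>, so that for every index set, also outside of \<open>\<Delta> r\<close>, the function
  \<open>partial_sum r f\<close> is the partial sum in the definition of the multiple integral.
\<close>

definition monomial :: "'d list \<Rightarrow> nat list \<Rightarrow> (nat \<Rightarrow> nat) \<Rightarrow> real" where
  "monomial ks is \<omega> = (\<Prod>l<length ks. walk v (is ! l) \<omega> $ (ks ! l))"

definition partial_sum :: "nat \<Rightarrow> ('d list \<Rightarrow> nat list \<Rightarrow> real) \<Rightarrow> nat list set \<Rightarrow> (nat \<Rightarrow> nat) \<Rightarrow> real" where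
  "partial_sum r f A \<omega> = (\<Sum>ks\<in>multi_indices r. \<Sum>is\<in>A. f ks is * monomial ks is \<omega>)"

lemma monomial_measurable:
  assumes "\<And>l. l < length ks \<Longrightarrow> is ! l < N"
  shows "monomial ks is \<in> borel_measurable (past P N)"
  unfolding monomial_def[abs_def]
  using assms by (intro borel_measurable_prod measurable_past_mono[OF _ walk_measurable] Suc_leI) simp

lemma monomial_L2: "monomial ks is \<in> L2 P"
proof -
  have "is ! l < Suc (Max ((!) is ` {..<length ks}))" if "l < length ks" for l
    unfolding less_Suc_eq_le by (rule Max_ge) (use that in auto)
  then show ?thesis by (rule measurable_past_L2[OF monomial_measurable])
qed

lemma monomial_eq_word:
  assumes len: "length ks = length is" and "distinct is" "set is \<subseteq> {..<N}"
  shows "monomial ks is \<omega> = word (map_of (zip is ks)) N \<omega>"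
proof -
  let ?a = "map_of (zip is ks)"
  have "word ?a N \<omega> = (\<Prod>i\<in>set is. letter (?a i) i \<omega>)"
    unfolding word_def using assms
    by (intro prod.mono_neutral_right) (auto simp: letter_def split: option.split dest!: map_of_SomeD set_zip_leftD)
  also have "\<dots> = (\<Prod>l<length is. letter (?a (is ! l)) (is ! l) \<omega>)"
    using bij_betw_nth[OF \<open>distinct is\<close> refl refl] by (rule prod.reindex_bij_betw[symmetric])
  also have "\<dots> = monomial ks is \<omega>"
    unfolding monomial_def len using assms
    by (intro prod.cong refl) (simp add: letter_def map_of_zip_nth)
  finally show ?thesis ..
qed

lemma cond_exp_monomial:
  assumes "length ks = length is" "distinct is"
  shows "AE \<omega> in P. real_cond_exp P (past P k) (monomial ks is) \<omega>
    = of_bool (set is \<subseteq> {..<k}) * monomial ks is \<omega>"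
proof (cases "set is \<subseteq> {..<k}")
  case True
  have "is ! l < k" if "l < length ks" for l
    using subsetD[OF True nth_mem[of l "is"]] that assms by simp
  then show ?thesis
    using past.real_cond_exp_F_meas[OF L2_integrable[OF monomial_L2] monomial_measurable] True by simp
next
  case False
  then obtain i where i: "i \<in> set is" "k \<le> i" by (meson lessThan_iff not_less subsetI)
  let ?N = "max k (Suc (Max (set is)))"
  have N: "set is \<subseteq> {..<?N}" by (auto simp: less_Suc_eq_le less_max_iff_disj)
  have "map_of (zip is ks) i \<noteq> None" using i assms by (simp add: map_of_zip_is_None)
  moreover have "i \<in> {k..<?N}" using i N by auto
  ultimately have zero: "of_bool (\<forall>i\<in>{k..<?N}. map_of (zip is ks) i = None) = (0::real)"
    by (subst of_bool_eq_0_iff) (rule notI, drule bspec, assumption, rule notE)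
  have "monomial ks is = word (map_of (zip is ks)) ?N"
    using monomial_eq_word[OF assms N] by (intro ext)
  then show ?thesis
    using False cond_exp_word[of k ?N "map_of (zip is ks)", unfolded zero] by simp
qed

text \<open>
  Below a common bound on the times both monomials are words of the same length. So monomials are
  orthonormal, once those that differ by a permutation are identified.
\<close>

lemma expectation_monomial_mult:
  assumes "length ks = length is" "distinct is" "length ks' = length is'" "distinct is'"
  shows "expectation (\<lambda>\<omega>. monomial ks is \<omega> * monomial ks' is' \<omega>)
    = of_bool (map_of (zip is ks) = map_of (zip is' ks'))"
proof -
  let ?N = "Suc (Max (set is \<union> set is'))"
  have N: "set is \<subseteq> {..<?N}" "set is' \<subseteq> {..<?N}"
    by (auto simp: less_Suc_eq_le intro!: Max_ge)
  have "map_of (zip is ks) i = None \<and> map_of (zip is' ks') i = None" if "\<not> i < ?N" for i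
    using that N assms by (auto simp: map_of_zip_is_None)
  then have "(\<forall>i<?N. map_of (zip is ks) i = map_of (zip is' ks') i)
      \<longleftrightarrow> map_of (zip is ks) = map_of (zip is' ks')"
    unfolding fun_eq_iff by metis
  then show ?thesis
    using monomial_eq_word[OF assms(1,2) N(1)] monomial_eq_word[OF assms(3,4) N(2)]
    by (simp add: expectation_word_mult)
qed

lemma partial_sum_L2: "partial_sum r f A \<in> L2 P"
  unfolding partial_sum_def[abs_def] by (intro L2_sum L2_cmult monomial_L2)

lemma partial_sum_diff:
  assumes "finite B" "A \<subseteq> B"
  shows "partial_sum r f B \<omega> - partial_sum r f A \<omega> = partial_sum r f (B - A) \<omega>"
  unfolding partial_sum_def
  by (simp add: sum_diff[OF assms] sum_subtractf[symmetric])

text \<open>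
  A monomial may occur several times in the sum, up to rearrangement, but at most \<open>r ^ r\<close> times:
  its list of pairs is one of the lists of length \<open>r\<close> over a set of at most \<open>r\<close> elements. So each row
  of the Gram matrix has at most \<open>r ^ r\<close> entries \<open>1\<close>, and \<open>2ab \<le> a\<^sup>2 + b\<^sup>2\<close> makes the quadratic form diagonal.
\<close>

lemma partial_sum_L2_bound:
  assumes A: "finite A" "A \<subseteq> \<Delta> r"
  shows "expectation (\<lambda>\<omega>. (partial_sum r f A \<omega>)\<^sup>2)
    \<le> real (r ^ r) * (\<Sum>is\<in>A. \<Sum>ks\<in>multi_indices r. (f ks is)\<^sup>2)"
proof -
  define X where "X = (multi_indices r :: 'd list set) \<times> A"
  define c where "c x = f (fst x) (snd x)" for x
  define t where "t x = monomial (fst x) (snd x)" for x :: "'d list \<times> nat list"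
  define m where "m x = map_of (zip (snd x) (fst x))" for x :: "'d list \<times> nat list"
  have fin: "finite X" using A finite_multi_indices by (auto simp: X_def)
  have X: "length (fst x) = r \<and> length (snd x) = r \<and> distinct (snd x)" if "x \<in> X" for x
    using that A by (auto simp: X_def multi_indices_def \<Delta>_def)
  have count: "card {y \<in> X. m y = m x} \<le> r ^ r" if x: "x \<in> X" for x
  proof -
    let ?S = "set (zip (snd x) (fst x))"
    let ?L = "{zs. set zs \<subseteq> ?S \<and> length zs = r}"
    have "{y \<in> X. m y = m x} \<subseteq> (\<lambda>zs. (map snd zs, map fst zs)) ` ?L"
    proof
      fix y assume y: "y \<in> {y \<in> X. m y = m x}"
      then have "mset (zip (snd y) (fst y)) = mset (zip (snd x) (fst x))"
        using map_of_zip_eq_iff[of "snd y" "fst y" "snd x" "fst x"] X[of y] X[OF x]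
        by (simp add: m_def)
      then have "set (zip (snd y) (fst y)) = ?S" by (rule mset_eq_setD)
      then have "zip (snd y) (fst y) \<in> ?L" using X[of y] y by simp
      moreover have "y = (map snd (zip (snd y) (fst y)), map fst (zip (snd y) (fst y)))"
        using X[of y] y by simp
      ultimately show "y \<in> (\<lambda>zs. (map snd zs, map fst zs)) ` ?L" by blast
    qed
    then have "card {y \<in> X. m y = m x} \<le> card ?L"
      by (intro surj_card_le) (simp_all add: finite_lists_length_eq)
    also have "\<dots> = card ?S ^ r" by (simp add: card_lists_length_eq)
    also have "\<dots> \<le> r ^ r"
      using X[OF x] card_length[of "zip (snd x) (fst x)"] by (intro power_mono) auto
    finally show ?thesis .
  qed
  have "expectation (\<lambda>\<omega>. (partial_sum r f A \<omega>)\<^sup>2)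
      = expectation (\<lambda>\<omega>. \<Sum>x\<in>X. \<Sum>y\<in>X. c x * c y * (t x \<omega> * t y \<omega>))"
    unfolding partial_sum_def sum.cartesian_product power2_eq_square sum_product
    by (simp add: X_def c_def t_def case_prod_beta mult_ac)
  also have "\<dots> = (\<Sum>x\<in>X. \<Sum>y\<in>X. c x * c y * expectation (\<lambda>\<omega>. t x \<omega> * t y \<omega>))"
    using L2_mult_integrable[OF monomial_L2 monomial_L2] by (simp add: t_def)
  also have "\<dots> = (\<Sum>x\<in>X. \<Sum>y\<in>X. c x * c y * of_bool (m x = m y))"
    using X by (intro sum.cong refl) (simp add: t_def m_def expectation_monomial_mult)
  also have "\<dots> \<le> (\<Sum>x\<in>X. \<Sum>y\<in>X. ((c x)\<^sup>2 * of_bool (m x = m y) + (c y)\<^sup>2 * of_bool (m x = m y)) / 2)"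
  proof (intro sum_mono)
    fix x y
    show "c x * c y * of_bool (m x = m y)
        \<le> ((c x)\<^sup>2 * of_bool (m x = m y) + (c y)\<^sup>2 * of_bool (m x = m y)) / 2"
      using sum_squares_bound[of "c x" "c y"] by (cases "m x = m y") auto
  qed
  also have "\<dots> = ((\<Sum>x\<in>X. \<Sum>y\<in>X. (c x)\<^sup>2 * of_bool (m x = m y))
      + (\<Sum>x\<in>X. \<Sum>y\<in>X. (c y)\<^sup>2 * of_bool (m x = m y))) / 2"
    by (simp only: sum.distrib sum_divide_distrib add_divide_distrib)
  also have "(\<Sum>x\<in>X. \<Sum>y\<in>X. (c y)\<^sup>2 * of_bool (m x = m y)) = (\<Sum>x\<in>X. \<Sum>y\<in>X. (c x)\<^sup>2 * of_bool (m x = m y))"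
    by (subst sum.swap) (simp add: eq_commute)
  also have "(\<Sum>x\<in>X. \<Sum>y\<in>X. (c x)\<^sup>2 * of_bool (m x = m y)) = (\<Sum>x\<in>X. (c x)\<^sup>2 * card {y \<in> X. m y = m x})"
    using fin by (intro sum.cong refl)
      (simp add: sum_distrib_left[symmetric] sum.inter_filter[symmetric] eq_commute of_bool_def)
  also have "((\<Sum>x\<in>X. (c x)\<^sup>2 * card {y \<in> X. m y = m x}) + (\<Sum>x\<in>X. (c x)\<^sup>2 * card {y \<in> X. m y = m x})) / 2
      \<le> (\<Sum>x\<in>X. (c x)\<^sup>2 * real (r ^ r))"
    using count by (auto intro!: sum_mono mult_left_mono simp del: of_nat_power)
  also have "\<dots> = real (r ^ r) * (\<Sum>x\<in>X. (c x)\<^sup>2)"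
    by (simp add: sum_distrib_left mult.commute)
  also have "(\<Sum>x\<in>X. (c x)\<^sup>2) = (\<Sum>is\<in>A. \<Sum>ks\<in>multi_indices r. (f ks is)\<^sup>2)"
    unfolding X_def c_def by (subst sum.swap) (simp add: sum.cartesian_product case_prod_beta)
  finally show ?thesis .
qed

text \<open>
  By \<open>partial_sum_L2_bound\<close> the partial sums of a square-summable kernel form a Cauchy net, so
  the choice in the definition of the multiple integral selects an actual limit.
\<close>

lemma multiple_integral_tendsto:
  assumes f: "square_summable r f"
  shows "L2_tendsto P (partial_sum r f) (multiple_integral P v r f) (finite_subsets_at_top (\<Delta> r))"
proof (cases "r = 0")
  case True
  have eq: "\<Delta> 0 = {[]}" "(multi_indices 0 :: 'd list set) = {[]}"
    by (auto simp: \<Delta>_def multi_indices_def)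
  have "partial_sum 0 f {[]} = (\<lambda>_. f [] [])"
    by (intro ext) (simp add: partial_sum_def eq monomial_def)
  then show ?thesis
    using True L2_const[of "f [] []"]
    by (auto simp: eq finite_subsets_at_top_finite L2_tendsto_def multiple_integral_def
        eventually_principal intro!: tendsto_eventually)
next
  case False
  have "\<exists>G. L2_tendsto P (partial_sum r f) G (finite_subsets_at_top (\<Delta> r))"
  proof (rule L2_complete_net)
    fix e :: real assume "e > 0"
    define n where "n is = (\<Sum>ks\<in>multi_indices r. (f ks is)\<^sup>2)" for "is"
    define C where "C = real (r ^ r) + 1"
    have C: "C > 0" "real (r ^ r) \<le> C" by (auto simp: C_def add_nonneg_pos)
    define s where "s = infsum n (\<Delta> r)"
    have n: "n is \<ge> 0" for "is" by (auto simp: n_def intro: sum_nonneg)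
    have "n summable_on \<Delta> r" using f by (simp add: n_def[abs_def])
    then have "(sum n \<longlongrightarrow> s) (finite_subsets_at_top (\<Delta> r))"
      using has_sum_infsum unfolding s_def has_sum_def by blast
    then have "\<forall>\<^sub>F A in finite_subsets_at_top (\<Delta> r). dist (sum n A) s < e / (2 * C)"
      using \<open>e > 0\<close> C by (intro tendstoD) auto
    then obtain A where "finite A \<and> A \<subseteq> \<Delta> r \<and>
        (\<forall>B. finite B \<and> A \<subseteq> B \<and> B \<subseteq> \<Delta> r \<longrightarrow> dist (sum n B) s < e / (2 * C))"
      unfolding eventually_finite_subsets_at_top ..
    then have A: "finite A" "A \<subseteq> \<Delta> r"
      "\<And>B. finite B \<Longrightarrow> A \<subseteq> B \<Longrightarrow> B \<subseteq> \<Delta> r \<Longrightarrow> dist (sum n B) s < e / (2 * C)"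
      by simp_all
    have "expectation (\<lambda>\<omega>. (partial_sum r f B \<omega> - partial_sum r f A \<omega>)\<^sup>2) \<le> e"
      if B: "finite B" "A \<subseteq> B" "B \<subseteq> \<Delta> r" for B
    proof -
      have "expectation (\<lambda>\<omega>. (partial_sum r f B \<omega> - partial_sum r f A \<omega>)\<^sup>2)
          = expectation (\<lambda>\<omega>. (partial_sum r f (B - A) \<omega>)\<^sup>2)"
        using partial_sum_diff[OF B(1,2)] by simp
      also have "\<dots> \<le> real (r ^ r) * sum n (B - A)"
        unfolding n_def using B by (intro partial_sum_L2_bound) auto
      also have "\<dots> \<le> C * sum n (B - A)"
        using C n by (intro mult_right_mono sum_nonneg) auto
      also have "sum n (B - A) = sum n B - sum n A"
        using B(1,2) by (rule sum_diff)
      also have "\<dots> \<le> e / (2 * C) + e / (2 * C)"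
        using A(3)[OF B] A(3)[OF A(1) order_refl A(2)] unfolding dist_real_def by linarith
      also have "C * (e / (2 * C) + e / (2 * C)) = e" using C by (simp add: field_simps)
      finally show ?thesis using C by (simp add: mult_left_mono)
    qed
    then show "\<exists>A. finite A \<and> A \<subseteq> \<Delta> r \<and> (\<forall>B. finite B \<longrightarrow> A \<subseteq> B \<longrightarrow> B \<subseteq> \<Delta> r \<longrightarrow>
        expectation (\<lambda>\<omega>. (partial_sum r f B \<omega> - partial_sum r f A \<omega>)\<^sup>2) \<le> e)"
      by (intro exI[of _ A] conjI A(1,2)) simp
  qed (rule partial_sum_L2)
  moreover have "(\<lambda>A \<omega>. \<Sum>ks\<in>multi_indices r. \<Sum>is\<in>A. f ks is * (\<Prod>l<r. walk v (is ! l) \<omega> $ (ks ! l)))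
      = partial_sum r f"
    unfolding partial_sum_def[abs_def] monomial_def multi_indices_def
    by (intro ext sum.cong refl) simp
  then have "multiple_integral P v r f
      = (SOME G. L2_tendsto P (partial_sum r f) G (finite_subsets_at_top (\<Delta> r)))"
    using False by (simp add: multiple_integral_def)
  ultimately show ?thesis using someI_ex by metis
qed

end

section \<open>Conditional expectations of multiple integrals\<close>

definition below :: "nat \<Rightarrow> nat \<Rightarrow> nat list set" where
  "below r k = {is \<in> \<Delta> r. set is \<subseteq> {..<k}}"

lemma below_subset: "below r k \<subseteq> \<Delta> r"
  by (auto simp: below_def)

lemma finite_below: "finite (below r k)"
  by (rule finite_subset[OF _ finite_lists_length_eq[of "{..<k}" r]]) (auto simp: below_def \<Delta>_def)

lemma below_mono: "k \<le> m \<Longrightarrow> below r k \<subseteq> below r m"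
  by (auto simp: below_def)

text \<open>
  The initial sets \<open>below r k\<close> are cofinal, so the net limit is also the limit along this sequence. This turns the
  unordered series of the multiple integrals into limits in time.
\<close>

lemma filterlim_below: "filterlim (below r) (finite_subsets_at_top (\<Delta> r)) sequentially"
  unfolding filterlim_finite_subsets_at_top
proof (intro allI impI)
  fix X assume X: "finite X \<and> X \<subseteq> \<Delta> r"
  let ?m = "Max (\<Union>(set ` X))"
  have *: "X \<subseteq> below r k" if "k \<ge> Suc ?m" for k
  proof
    fix "is" assume "is": "is \<in> X"
    have "i \<le> ?m" if "i \<in> set is" for i
      using "is" X that by (intro Max_ge) auto
    then show "is \<in> below r k" using "is" X that by (force simp: below_def)
  qed
  show "\<forall>\<^sub>F k in sequentially. finite (below r k) \<and> X \<subseteq> below r k \<and> below r k \<subseteq> \<Delta> r"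
    using eventually_ge_at_top[of "Suc ?m"]
    by eventually_elim (simp add: * finite_below below_subset)
qed

lemma square_summable_slice:
  fixes f :: "'d::finite list \<Rightarrow> nat list \<Rightarrow> real"
  assumes "square_summable (Suc r) f"
  shows "square_summable r (kernel_slice f j k)"
proof -
  define n where "n is = (\<Sum>ks\<in>multi_indices (Suc r). (f ks is)\<^sup>2)" for "is"
  let ?D = "{is \<in> \<Delta> r. k \<notin> set is}"
  have inj: "inj_on (\<lambda>is. is @ [k]) ?D" by (auto simp: inj_on_def)
  have sub: "(\<lambda>is. is @ [k]) ` ?D \<subseteq> \<Delta> (Suc r)" by (auto simp: \<Delta>_def)
  have "n summable_on \<Delta> (Suc r)" unfolding n_def[abs_def] by (rule assms)
  then have "n summable_on (\<lambda>is. is @ [k]) ` ?D" using sub by (rule summable_on_subset_banach)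
  then have "(\<lambda>is. n (is @ [k])) summable_on ?D"
    by (simp add: summable_on_reindex[OF inj] o_def)
  then have "(\<lambda>is. \<Sum>ks\<in>multi_indices r. (kernel_slice f j k ks is)\<^sup>2) summable_on ?D"
  proof (rule summable_on_comparison_test)
    fix "is" assume "is \<in> ?D"
    then have "(\<Sum>ks\<in>multi_indices r. (kernel_slice f j k ks is)\<^sup>2)
        = (\<Sum>ks\<in>(\<lambda>ks. ks @ [j]) ` multi_indices r. (f ks (is @ [k]))\<^sup>2)"
      by (subst sum.reindex) (auto simp: kernel_slice_def inj_on_def)
    also have "\<dots> \<le> n (is @ [k])"
      unfolding n_def
      by (intro sum_mono2 finite_multi_indices) (auto simp: multi_indices_def)
    finally show "(\<Sum>ks\<in>multi_indices r. (kernel_slice f j k ks is)\<^sup>2) \<le> n (is @ [k])" .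
  qed (auto intro: sum_nonneg)
  then show ?thesis
    by (rule summable_on_cong_neutral[THEN iffD1, rotated -1]) (auto simp: kernel_slice_def)
qed

lemma sym_L2_truncate:
  fixes f :: "'d::finite list \<Rightarrow> nat list \<Rightarrow> real"
  assumes "f \<in> sym_L2_kernels r"
  shows "(\<lambda>ks is. if set is \<subseteq> {..<k} then f ks is else 0) \<in> sym_L2_kernels r"
proof -
  have "set (permute_list p is) = set is" if "p permutes {..<r}" "is \<in> \<Delta> r" for p "is"
    using that set_permute_list[of p "is"] by (simp add: \<Delta>_def)
  moreover have "square_summable r (\<lambda>ks is. if set is \<subseteq> {..<k} then f ks is else 0)"
    by (rule summable_on_comparison_test[of "\<lambda>is. \<Sum>ks\<in>multi_indices r. (f ks is)\<^sup>2"])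
      (use assms in \<open>auto simp: sym_L2_kernels_def intro: sum_mono sum_nonneg\<close>)
  ultimately show ?thesis using assms by (auto simp: sym_L2_kernels_def symmetric_kernel_def)
qed

context obtuse_random_walk
begin

lemma cond_exp_partial_sum:
  assumes A: "finite A" "A \<subseteq> \<Delta> r"
  shows "AE \<omega> in P. real_cond_exp P (past P k) (partial_sum r f A) \<omega> = partial_sum r f (A \<inter> below r k) \<omega>"
proof -
  define X where "X = (multi_indices r :: 'd list set) \<times> A"
  define t where "t x \<omega> = f (fst x) (snd x) * monomial (fst x) (snd x) \<omega>" for x \<omega>
  have fin: "finite X" using A finite_multi_indices by (auto simp: X_def)
  have S: "partial_sum r f A = (\<lambda>\<omega>. \<Sum>x\<in>X. t x \<omega>)"
    unfolding partial_sum_def[abs_def] X_def t_def by (simp add: sum.cartesian_product case_prod_beta)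
  have "AE \<omega> in P. real_cond_exp P (past P k) (\<lambda>\<omega>. \<Sum>x\<in>X. t x \<omega>) \<omega>
      = (\<Sum>x\<in>X. real_cond_exp P (past P k) (t x) \<omega>)"
    unfolding t_def by (intro past.real_cond_exp_sum L2_integrable L2_cmult monomial_L2)
  moreover have "AE \<omega> in P. \<forall>x\<in>X. real_cond_exp P (past P k) (t x) \<omega>
      = of_bool (set (snd x) \<subseteq> {..<k}) * t x \<omega>"
  proof (rule AE_finite_allI[OF fin])
    fix x assume "x \<in> X"
    then have x: "length (fst x) = length (snd x)" "distinct (snd x)"
      using A by (auto simp: X_def multi_indices_def \<Delta>_def)
    have "AE \<omega> in P. real_cond_exp P (past P k) (t x) \<omega>
        = f (fst x) (snd x) * real_cond_exp P (past P k) (monomial (fst x) (snd x)) \<omega>"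
      unfolding t_def by (intro past.real_cond_exp_cmult L2_integrable monomial_L2)
    then show "AE \<omega> in P. real_cond_exp P (past P k) (t x) \<omega> = of_bool (set (snd x) \<subseteq> {..<k}) * t x \<omega>"
      using cond_exp_monomial[OF x, of k] by eventually_elim (simp add: t_def)
  qed
  ultimately show ?thesis
  proof eventually_elim
    case (elim \<omega>)
    then have "real_cond_exp P (past P k) (partial_sum r f A) \<omega>
        = (\<Sum>x\<in>X. of_bool (set (snd x) \<subseteq> {..<k}) * t x \<omega>)"
      by (simp add: S)
    also have "\<dots> = (\<Sum>x\<in>multi_indices r \<times> (A \<inter> below r k). t x \<omega>)"
      using A fin by (intro sum.mono_neutral_cong_right) (auto simp: X_def below_def)
    finally show ?case
      unfolding partial_sum_def t_def by (simp add: sum.cartesian_product case_prod_beta)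
  qed
qed

lemma partial_sum_below_measurable: "partial_sum r f (below r k) \<in> borel_measurable (past P k)"
proof -
  have "monomial ks is \<in> borel_measurable (past P k)"
    if "ks \<in> multi_indices r" "is \<in> below r k" for ks :: "'d list" and "is"
  proof (rule monomial_measurable)
    fix l assume "l < length ks"
    then show "is ! l < k"
      using that subsetD[OF _ nth_mem[of l "is"], of "{..<k}"]
      by (simp add: below_def \<Delta>_def multi_indices_def)
  qed
  then show ?thesis
    unfolding partial_sum_def[abs_def]
    by (intro borel_measurable_sum borel_measurable_times borel_measurable_const)
qed

lemma multiple_integral_L2: "square_summable r f \<Longrightarrow> multiple_integral P v r f \<in> L2 P"
  using multiple_integral_tendsto by (auto simp: L2_tendsto_def)

text \<open>
  Conditioning a partial sum keeps its terms with all times below \<open>k\<close>, so the result no longer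
  changes once all of the finitely many tuples in \<open>below r k\<close> are included. Integrals over past events
  are continuous in \<open>L\<^sup>2\<close>, which carries this to the limit.
\<close>

lemma cond_exp_multiple_integral:
  assumes f: "square_summable r f"
  shows "AE \<omega> in P. real_cond_exp P (past P k) (multiple_integral P v r f) \<omega>
    = partial_sum r f (below r k) \<omega>"
proof (rule past.real_cond_exp_charact)
  let ?I = "multiple_integral P v r f" and ?S = "partial_sum r f"
  note IL = multiple_integral_L2[OF f]
  show "integrable P ?I" by (rule L2_integrable[OF IL])
  show "integrable P (?S (below r k))" by (rule L2_integrable[OF partial_sum_L2])
  show "?S (below r k) \<in> borel_measurable (past P k)" by (rule partial_sum_below_measurable)
  fix A assume A: "A \<in> sets (past P k)"
  then have AP: "A \<in> sets P" using subalgebra_past by (auto simp: subalgebra_def)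
  have ind: "(\<lambda>\<omega>. indicator A \<omega> * h \<omega>) \<in> L2 P" if "h \<in> L2 P" for h
    using L2_mult_past[OF that borel_measurable_indicator[OF A]] by (simp add: mult.commute)
  define D where "D = (\<integral>\<omega>\<in>A. ?I \<omega> \<partial>P) - (\<integral>\<omega>\<in>A. ?S (below r k) \<omega> \<partial>P)"
  have bound: "D\<^sup>2 \<le> expectation (\<lambda>\<omega>. (?S B \<omega> - ?I \<omega>)\<^sup>2)"
    if B: "finite B" "below r k \<subseteq> B" "B \<subseteq> \<Delta> r" for B
  proof -
    define h where "h \<omega> = indicator A \<omega> * (?I \<omega> - ?S B \<omega>)" for \<omega>
    have h: "h \<in> L2 P" unfolding h_def[abs_def] by (intro ind L2_diff IL partial_sum_L2)
    have "(\<integral>\<omega>\<in>A. ?S (below r k) \<omega> \<partial>P) = (\<integral>\<omega>\<in>A. real_cond_exp P (past P k) (?S B) \<omega> \<partial>P)"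
    proof -
      have "AE \<omega> in P. ?S (below r k) \<omega> = real_cond_exp P (past P k) (?S B) \<omega>"
        using cond_exp_partial_sum[OF B(1,3), of k f] B(2) by (simp add: Int_absorb1 eq_commute)
      then show ?thesis
        unfolding set_lebesgue_integral_def using AP L2_D(1)[OF partial_sum_L2]
        by (intro integral_cong_AE) auto
    qed
    also have "\<dots> = (\<integral>\<omega>\<in>A. ?S B \<omega> \<partial>P)"
      by (rule past.real_cond_exp_intA[symmetric, OF L2_integrable[OF partial_sum_L2] A])
    finally have "D = expectation h"
      using ind[OF IL, THEN L2_integrable] ind[OF partial_sum_L2, THEN L2_integrable]
      by (simp add: D_def set_lebesgue_integral_def h_def[abs_def] right_diff_distrib)
    then have "D\<^sup>2 \<le> expectation (\<lambda>\<omega>. (h \<omega>)\<^sup>2)"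
      using variance_positive[of h] variance_eq[OF L2_integrable[OF h] L2_D(2)[OF h]] by simp
    also have "\<dots> \<le> expectation (\<lambda>\<omega>. (?S B \<omega> - ?I \<omega>)\<^sup>2)"
      using L2_D(2)[OF h] L2_D(2)[OF L2_diff[OF partial_sum_L2 IL]]
      by (intro integral_mono) (auto simp: h_def indicator_def power2_commute)
    finally show ?thesis .
  qed
  have "((\<lambda>B. expectation (\<lambda>\<omega>. (?S B \<omega> - ?I \<omega>)\<^sup>2)) \<longlongrightarrow> 0) (finite_subsets_at_top (\<Delta> r))"
    using multiple_integral_tendsto[OF f] by (simp add: L2_tendsto_def)
  moreover have "\<forall>\<^sub>F B in finite_subsets_at_top (\<Delta> r). D\<^sup>2 \<le> expectation (\<lambda>\<omega>. (?S B \<omega> - ?I \<omega>)\<^sup>2)"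
    unfolding eventually_finite_subsets_at_top
    by (intro exI[of _ "below r k"] conjI finite_below below_subset allI impI bound) auto
  ultimately have "D\<^sup>2 \<le> 0"
    by (rule tendsto_lowerbound) simp
  then show "(\<integral>\<omega>\<in>A. ?I \<omega> \<partial>P) = (\<integral>\<omega>\<in>A. ?S (below r k) \<omega> \<partial>P)"
    by (simp add: D_def)
qed

text \<open>
  For a kernel supported in \<open>below r k\<close> the net of partial sums is eventually constant.
\<close>

lemma multiple_integral_supported:
  assumes f: "square_summable r f"
    and supp: "\<And>ks is. ks \<in> multi_indices r \<Longrightarrow> is \<in> \<Delta> r - below r k \<Longrightarrow> f ks is = 0"
  shows "AE \<omega> in P. multiple_integral P v r f \<omega> = partial_sum r f (below r k) \<omega>"
proof (rule L2_tendsto_unique[OF multiple_integral_tendsto[OF f] _ finite_subsets_at_top_neq_bot])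
  have eq: "partial_sum r f B = partial_sum r f (below r k)"
    if "finite B" "below r k \<subseteq> B" "B \<subseteq> \<Delta> r" for B
    unfolding partial_sum_def
    by (intro ext sum.cong refl sum.mono_neutral_right) (use that supp in auto)
  have "\<forall>\<^sub>F B in finite_subsets_at_top (\<Delta> r). partial_sum r f B = partial_sum r f (below r k)"
    unfolding eventually_finite_subsets_at_top
    by (intro exI[of _ "below r k"] conjI finite_below below_subset allI impI eq) auto
  then have "\<forall>\<^sub>F B in finite_subsets_at_top (\<Delta> r). partial_sum r f B \<in> borel_measurable P \<and>
      (AE \<omega> in P. partial_sum r f B \<omega> = partial_sum r f (below r k) \<omega>)"
    by eventually_elim (simp add: L2_D(1)[OF partial_sum_L2])
  then show "L2_tendsto P (partial_sum r f) (partial_sum r f (below r k)) (finite_subsets_at_top (\<Delta> r))"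
    by (rule L2_tendsto_cong_AE[OF L2_tendsto_const[OF partial_sum_L2]])
      (simp_all add: L2_D(1)[OF partial_sum_L2])
qed

end

section \<open>Increments of truncated integrals\<close>

lemma permute_list_involution:
  "p permutes {..<length xs} \<Longrightarrow> p \<circ> p = id \<Longrightarrow> permute_list p (permute_list p xs) = xs"
  using permute_list_compose[of p xs p] by simp

context obtuse_random_walk
begin

lemma monomial_permute:
  assumes "p permutes {..<r}" "length ks = r" "length is = r"
  shows "monomial (permute_list p ks) (permute_list p is) \<omega> = monomial ks is \<omega>"
proof -
  have "monomial (permute_list p ks) (permute_list p is) \<omega> = (\<Prod>l<r. walk v (is ! p l) \<omega> $ (ks ! p l))"
    unfolding monomial_def using assms by (intro prod.cong) (simp_all add: permute_list_nth)
  also have "\<dots> = monomial ks is \<omega>"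
    unfolding monomial_def using prod.permute[OF assms(1), of "\<lambda>l. walk v (is ! l) \<omega> $ (ks ! l)"] assms
    by (simp add: o_def)
  finally show ?thesis .
qed

text \<open>
  Permuting times and components simultaneously changes neither a symmetric kernel nor a monomial,
  so it only reindexes the sum. An involution serves as its own inverse in the reindexing.
\<close>

lemma partial_sum_permute:
  assumes f: "symmetric_kernel r f" and p: "p permutes {..<r}" "p \<circ> p = id"
    and A: "A \<subseteq> \<Delta> r" "B \<subseteq> \<Delta> r"
    and AB: "\<And>is. is \<in> A \<Longrightarrow> permute_list p is \<in> B" "\<And>is. is \<in> B \<Longrightarrow> permute_list p is \<in> A"
  shows "partial_sum r f A \<omega> = partial_sum r f B \<omega>"
proof -
  let ?g = "\<lambda>(ks :: 'd list, is :: nat list). (permute_list p ks, permute_list p is)"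
  have "(\<Sum>(ks, is)\<in>multi_indices r \<times> A. f ks is * monomial ks is \<omega>)
      = (\<Sum>(ks, is)\<in>multi_indices r \<times> B. f ks is * monomial ks is \<omega>)"
  proof (rule sum.reindex_bij_witness[where i = ?g and j = ?g])
    fix x :: "'d list \<times> nat list" assume x: "x \<in> multi_indices r \<times> A"
    then obtain ks "is" where [simp]: "x = (ks, is)" and mem: "ks \<in> multi_indices r" "is \<in> A" by auto
    then have len: "length ks = r" "length is = r" using A by (auto simp: multi_indices_def \<Delta>_def)
    show "?g (?g x) = x" using len p by (simp add: permute_list_involution)
    show "?g x \<in> multi_indices r \<times> B" using mem AB by (auto simp: multi_indices_def)
    show "(case ?g x of (ks, is) \<Rightarrow> f ks is * monomial ks is \<omega>) = (case x of (ks, is) \<Rightarrow> f ks is * monomial ks is \<omega>)"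
      using f p mem A len by (auto simp: symmetric_kernel_def monomial_permute)
  next
    fix x :: "'d list \<times> nat list" assume x: "x \<in> multi_indices r \<times> B"
    then obtain ks "is" where [simp]: "x = (ks, is)" and mem: "ks \<in> multi_indices r" "is \<in> B" by auto
    then have len: "length ks = r" "length is = r" using A by (auto simp: multi_indices_def \<Delta>_def)
    show "?g (?g x) = x" using len p by (simp add: permute_list_involution)
    show "?g x \<in> multi_indices r \<times> A" using mem AB by (auto simp: multi_indices_def)
  qed
  then show ?thesis by (simp add: partial_sum_def sum.cartesian_product)
qed

text \<open>
  Splitting off the last entry of both lists turns the terms with time \<open>k\<close> in the last place into the
  terms of the sliced kernels, times a component of \<open>Y\<^sub>k\<close>.
\<close>

lemma partial_sum_last:
  "partial_sum (Suc r) f {is \<in> below (Suc r) (Suc k). is ! r = k} \<omega>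
    = (\<Sum>j\<in>UNIV. partial_sum r (kernel_slice f j k) (below r k) \<omega> * walk v k \<omega> $ j)"
proof -
  have A: "{is \<in> below (Suc r) (Suc k). is ! r = k} = (\<lambda>is. is @ [k]) ` below r k"
  proof (intro equalityI subsetI)
    fix "is" assume "is": "is \<in> {is \<in> below (Suc r) (Suc k). is ! r = k}"
    then obtain js i where [simp]: "is = js @ [i]"
      by (cases "is" rule: rev_cases) (auto simp: below_def \<Delta>_def)
    have "i = k" "js \<in> below r k"
      using "is" by (auto simp: below_def \<Delta>_def less_Suc_eq)
    then show "is \<in> (\<lambda>is. is @ [k]) ` below r k" by simp
  qed (auto simp: below_def \<Delta>_def)
  have M: "(multi_indices (Suc r) :: 'd list set) = (\<lambda>(ks, j). ks @ [j]) ` (multi_indices r \<times> UNIV)"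
  proof (intro equalityI subsetI)
    fix ks :: "'d list" assume "ks \<in> multi_indices (Suc r)"
    then show "ks \<in> (\<lambda>(ks, j). ks @ [j]) ` (multi_indices r \<times> UNIV)"
      by (cases ks rule: rev_cases) (auto simp: multi_indices_def)
  qed (auto simp: multi_indices_def)
  have mono: "monomial (ks @ [j]) (is @ [k]) \<omega> = monomial ks is \<omega> * walk v k \<omega> $ j"
    if "length ks = length is" for ks j "is"
    using that by (simp add: monomial_def nth_append)
  have "partial_sum (Suc r) f {is \<in> below (Suc r) (Suc k). is ! r = k} \<omega>
      = (\<Sum>ks\<in>multi_indices r. \<Sum>j\<in>UNIV. \<Sum>is\<in>below r k. f (ks @ [j]) (is @ [k]) * monomial (ks @ [j]) (is @ [k]) \<omega>)"
  proof -
    have inj: "inj_on (\<lambda>(ks, j). ks @ [j]) (multi_indices r \<times> UNIV)" "inj_on (\<lambda>is. is @ [k]) (below r k)"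
      by (auto simp: inj_on_def)
    show ?thesis
      unfolding partial_sum_def A M sum.reindex[OF inj(1)] sum.reindex[OF inj(2)]
      by (subst sum.cartesian_product[of _ _ "multi_indices r"]) (simp add: case_prod_beta o_def)
  qed
  also have "\<dots> = (\<Sum>ks\<in>multi_indices r. \<Sum>j\<in>UNIV. \<Sum>is\<in>below r k.
      kernel_slice f j k ks is * monomial ks is \<omega> * walk v k \<omega> $ j)"
    by (intro sum.cong refl, subst mono)
      (auto simp: kernel_slice_def below_def \<Delta>_def multi_indices_def)
  also have "\<dots> = (\<Sum>j\<in>UNIV. partial_sum r (kernel_slice f j k) (below r k) \<omega> * walk v k \<omega> $ j)"
    unfolding partial_sum_def sum_distrib_right by (rule sum.swap)
  finally show ?thesis .
qed

text \<open>
  The tuples that enter when the bound grows from \<open>k\<close> to \<open>Suc k\<close> are those in which \<open>k\<close> occurs, and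
  it occurs at exactly one place \<open>l\<close>. The transposition of \<open>l\<close> with the last place moves it there. This is
  the origin of the factor \<open>r\<close> in the definition of the gradient.
\<close>

lemma partial_sum_increment:
  assumes f: "symmetric_kernel (Suc r) f"
  shows "partial_sum (Suc r) f (below (Suc r) (Suc k)) \<omega> - partial_sum (Suc r) f (below (Suc r) k) \<omega>
    = (\<Sum>j\<in>UNIV. real (Suc r) * partial_sum r (kernel_slice f j k) (below r k) \<omega> * walk v k \<omega> $ j)"
proof -
  let ?B = "\<lambda>l. {is \<in> below (Suc r) (Suc k). is ! l = k}"
  have U: "below (Suc r) (Suc k) - below (Suc r) k = (\<Union>l<Suc r. ?B l)"
  proof (intro equalityI subsetI)
    fix "is" assume "is": "is \<in> below (Suc r) (Suc k) - below (Suc r) k"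
    then obtain i where "i \<in> set is" "\<not> i < k" by (auto simp: below_def)
    moreover have "i < Suc k" if "i \<in> set is" for i using "is" that by (auto simp: below_def)
    ultimately have "k \<in> set is" by (metis less_SucE)
    then show "is \<in> (\<Union>l<Suc r. ?B l)" using "is" by (auto simp: in_set_conv_nth below_def \<Delta>_def)
  next
    fix "is" assume "is \<in> (\<Union>l<Suc r. ?B l)"
    then obtain l where l: "l < Suc r" "is \<in> below (Suc r) (Suc k)" "is ! l = k" by auto
    then have "k \<in> set is" by (auto simp: below_def \<Delta>_def in_set_conv_nth)
    then show "is \<in> below (Suc r) (Suc k) - below (Suc r) k" using l by (auto simp: below_def)
  qed
  have "partial_sum (Suc r) f (below (Suc r) (Suc k)) \<omega> - partial_sum (Suc r) f (below (Suc r) k) \<omega>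
      = partial_sum (Suc r) f (\<Union>l<Suc r. ?B l) \<omega>"
    unfolding U[symmetric] by (rule partial_sum_diff[OF finite_below below_mono]) simp
  also have "\<dots> = (\<Sum>l<Suc r. partial_sum (Suc r) f (?B l) \<omega>)"
  proof -
    have disj: "?B l \<inter> ?B m = {}" if "l < Suc r" "m < Suc r" "l \<noteq> m" for l m
      using that nth_eq_iff_index_eq by (fastforce simp: below_def \<Delta>_def)
    have "(\<Sum>is\<in>(\<Union>l<Suc r. ?B l). h is) = (\<Sum>l<Suc r. sum h (?B l))" for h :: "nat list \<Rightarrow> real"
      by (rule sum.UNION_disjoint) (use disj in \<open>auto intro: finite_subset[OF _ finite_below]\<close>)
    then show ?thesis unfolding partial_sum_def by (simp only: sum.swap[of _ "multi_indices _"])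
  qed
  also have "\<dots> = (\<Sum>l<Suc r. partial_sum (Suc r) f (?B r) \<omega>)"
  proof (intro sum.cong refl)
    fix l assume l: "l \<in> {..<Suc r}"
    let ?p = "Transposition.transpose l r"
    have p: "?p permutes {..<Suc r}" using l by (intro permutes_swap_id) auto
    have mem: "permute_list ?p is \<in> below (Suc r) (Suc k)" if "is \<in> below (Suc r) (Suc k)" for "is"
      using that p by (simp add: below_def \<Delta>_def)
    have nth: "permute_list ?p is ! m = is ! ?p m" if "is \<in> below (Suc r) (Suc k)" "m < Suc r" for "is" m
      using that p by (intro permute_list_nth) (auto simp: below_def \<Delta>_def)
    show "partial_sum (Suc r) f (?B l) \<omega> = partial_sum (Suc r) f (?B r) \<omega>"
      by (rule partial_sum_permute[OF f p])
        (use l mem nth in \<open>auto simp: below_def\<close>)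
  qed
  also have "\<dots> = real (Suc r) * partial_sum (Suc r) f (?B r) \<omega>" by simp
  also have "\<dots> = (\<Sum>j\<in>UNIV. real (Suc r) * partial_sum r (kernel_slice f j k) (below r k) \<omega> * walk v k \<omega> $ j)"
    unfolding partial_sum_last sum_distrib_left by (simp add: mult.assoc)
  finally show ?thesis .
qed

text \<open>
  By orthonormality only the rearrangements of the given monomial survive, and a symmetric kernel takes the same
  value at all of them. For different orders \<open>r\<close> and \<open>r0\<close> there are none.
\<close>

lemma expectation_partial_sum_monomial:
  assumes f: "symmetric_kernel r f" and A: "finite A" "A \<subseteq> \<Delta> r"
    and mem: "ks0 \<in> multi_indices r0" "is0 \<in> \<Delta> r0"
  shows "expectation (\<lambda>\<omega>. partial_sum r f A \<omega> * monomial ks0 is0 \<omega>)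
    = (if r = r0 then real (card {(ks, is) \<in> multi_indices r \<times> A. map_of (zip is ks) = map_of (zip is0 ks0)}) * f ks0 is0 else 0)"
proof -
  let ?X = "(multi_indices r :: 'd list set) \<times> A"
  let ?C = "{(ks, is) \<in> multi_indices r \<times> A. map_of (zip is ks) = map_of (zip is0 ks0)}"
  have fin: "finite ?X" using A finite_multi_indices by auto
  have len0: "length ks0 = length is0" "distinct is0" using mem by (auto simp: multi_indices_def \<Delta>_def)
  have "expectation (\<lambda>\<omega>. partial_sum r f A \<omega> * monomial ks0 is0 \<omega>)
      = expectation (\<lambda>\<omega>. \<Sum>x\<in>?X. f (fst x) (snd x) * (monomial (fst x) (snd x) \<omega> * monomial ks0 is0 \<omega>))"
    unfolding partial_sum_def sum.cartesian_product sum_distrib_right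
    by (simp add: case_prod_beta mult.assoc)
  also have "\<dots> = (\<Sum>x\<in>?X. f (fst x) (snd x) * expectation (\<lambda>\<omega>. monomial (fst x) (snd x) \<omega> * monomial ks0 is0 \<omega>))"
    using L2_mult_integrable[OF monomial_L2 monomial_L2] by simp
  also have "\<dots> = (\<Sum>x\<in>?X. if x \<in> ?C then f (fst x) (snd x) else 0)"
  proof (intro sum.cong refl)
    fix x assume "x \<in> ?X"
    then have "length (fst x) = length (snd x)" "distinct (snd x)"
      using A by (auto simp: multi_indices_def \<Delta>_def)
    from expectation_monomial_mult[OF this len0] \<open>x \<in> ?X\<close>
    show "f (fst x) (snd x) * expectation (\<lambda>\<omega>. monomial (fst x) (snd x) \<omega> * monomial ks0 is0 \<omega>)
        = (if x \<in> ?C then f (fst x) (snd x) else 0)"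
      by (auto simp: case_prod_beta)
  qed
  also have "\<dots> = (\<Sum>x\<in>?C. f (fst x) (snd x))"
    using fin by (intro sum.mono_neutral_cong_right) auto
  also have "\<dots> = (if r = r0 then real (card ?C) * f ks0 is0 else 0)"
  proof (cases "r = r0")
    case True
    have "f (fst x) (snd x) = f ks0 is0" if "x \<in> ?C" for x
      using that A mem by (intro symmetric_kernel_eq[OF f]) (auto simp: True)
    then show ?thesis using True by simp
  next
    case False
    have "?C = {}"
    proof (rule equals0I)
      fix x assume "x \<in> ?C"
      then obtain ks "is" where x: "ks \<in> multi_indices r" "is \<in> \<Delta> r" "map_of (zip is ks) = map_of (zip is0 ks0)"
        using A by auto
      then have "set is = set is0"
        using mem dom_map_of_zip[of "is" ks] dom_map_of_zip[of is0 ks0]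
        by (simp add: multi_indices_def \<Delta>_def)
      then show False
        using x mem False distinct_card[of "is"] distinct_card[of is0] by (simp add: \<Delta>_def)
    qed
    then show ?thesis using False by (simp only: sum.empty if_False)
  qed
  finally show ?thesis .
qed

end

section \<open>The predictable representation\<close>

lemma symmetric_kernel_D: "f \<in> sym_L2_kernels r \<Longrightarrow> symmetric_kernel r f"
  and square_summable_D: "f \<in> sym_L2_kernels r \<Longrightarrow> square_summable r f"
  by (auto simp: sym_L2_kernels_def)

lemma square_summable_kernel_slice:
  "f \<in> sym_L2_kernels r \<Longrightarrow> 1 \<le> r \<Longrightarrow> square_summable (r - 1) (kernel_slice f j k)"
  using square_summable_slice[of f "r - 1" j k] square_summable_D[of f r] by simp

lemma below_0: "below 0 k = {[]}"
  by (auto simp: below_def \<Delta>_def)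

context obtuse_random_walk
begin

text \<open>
  This is \<open>\<E>[F | \<F>\<^sub>k\<^sub>-\<^sub>1]\<close> when the kernels \<open>f\<close> are those of \<open>F\<close>; see \<open>cond_exp_chaos\<close>.
\<close>

definition truncated_chaos :: "nat \<Rightarrow> (nat \<Rightarrow> 'd list \<Rightarrow> nat list \<Rightarrow> real) \<Rightarrow> nat \<Rightarrow> (nat \<Rightarrow> nat) \<Rightarrow> real" where
  "truncated_chaos n f k \<omega> = (\<Sum>r\<le>n. partial_sum r (f r) (below r k) \<omega>)"

lemma truncated_chaos_measurable: "truncated_chaos n f k \<in> borel_measurable (past P k)"
  unfolding truncated_chaos_def[abs_def] by (intro borel_measurable_sum partial_sum_below_measurable)

lemma cond_exp_chaos:
  assumes F: "F \<in> L2 P" and exp: "chaos_expansion P v F n f"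
  shows "AE \<omega> in P. real_cond_exp P (past P k) F \<omega> = truncated_chaos n f k \<omega>"
proof -
  have ss: "square_summable r (f r)" if "r \<le> n" for r
    using exp that square_summable_D by (auto simp: chaos_expansion_def)
  \<comment> \<open>set to zero for \<open>r > n\<close>, so that every member of the family is integrable\<close>
  define I where "I r = (if r \<le> n then multiple_integral P v r (f r) else (\<lambda>_. 0))" for r
  have I: "I r \<in> L2 P" for r using ss multiple_integral_L2 L2_zero by (auto simp: I_def)
  have "AE \<omega> in P. F \<omega> = (\<Sum>r\<le>n. I r \<omega>)" using exp by (simp add: chaos_expansion_def I_def)
  then have "AE \<omega> in P. real_cond_exp P (past P k) F \<omega> = real_cond_exp P (past P k) (\<lambda>\<omega>. \<Sum>r\<le>n. I r \<omega>) \<omega>"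
    using L2_D(1)[OF F] L2_D(1)[OF L2_sum[of "{..n}" I P, OF I]] by (intro past.real_cond_exp_cong)
  moreover have "AE \<omega> in P. real_cond_exp P (past P k) (\<lambda>\<omega>. \<Sum>r\<le>n. I r \<omega>) \<omega>
      = (\<Sum>r\<le>n. real_cond_exp P (past P k) (I r) \<omega>)"
    by (intro past.real_cond_exp_sum L2_integrable I)
  moreover have "AE \<omega> in P. \<forall>r\<in>{..n}. real_cond_exp P (past P k) (I r) \<omega> = partial_sum r (f r) (below r k) \<omega>"
    by (rule AE_finite_allI) (use ss cond_exp_multiple_integral in \<open>auto simp: I_def\<close>)
  ultimately show ?thesis by eventually_elim (simp add: truncated_chaos_def)
qed

lemma truncated_chaos_tendsto:
  assumes F: "F \<in> L2 P" and exp: "chaos_expansion P v F n f"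
  shows "L2_tendsto P (truncated_chaos n f) F sequentially"
proof -
  have ss: "square_summable r (f r)" if "r \<le> n" for r
    using exp that square_summable_D by (auto simp: chaos_expansion_def)
  have "L2_tendsto P (\<lambda>k. truncated_chaos n f k) (\<lambda>\<omega>. \<Sum>r\<le>n. multiple_integral P v r (f r) \<omega>) sequentially"
    unfolding truncated_chaos_def[abs_def]
    by (intro L2_tendsto_sum L2_tendsto_filterlim[OF multiple_integral_tendsto filterlim_below] ss) simp
  then show ?thesis
    by (rule L2_tendsto_cong_AE)
      (use exp in \<open>simp_all add: chaos_expansion_def L2_D(1)[OF F] measurable_past[OF truncated_chaos_measurable]\<close>)
qed

text \<open>
  The partial sums telescope to \<open>\<E>[F | \<F>\<^sub>m\<^sub>-\<^sub>1] - \<E>[F]\<close>, and the first term converges to \<open>F\<close>. Both series of the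
  theorem are of this form.
\<close>

lemma L2_sums_martingale_differences:
  assumes F: "F \<in> chaos_space P v"
    and g: "\<And>k. g k \<in> borel_measurable P"
    and diff: "\<And>k. AE \<omega> in P. g k \<omega>
      = real_cond_exp P (past P (Suc k)) F \<omega> - real_cond_exp P (past P k) F \<omega>"
  shows "L2_sums P g (\<lambda>\<omega>. F \<omega> - expectation F)"
proof -
  obtain n f where FL: "F \<in> L2 P" and exp: "chaos_expansion P v F n f"
    using F by (auto simp: chaos_space_def)
  let ?E = "\<lambda>k. real_cond_exp P (past P k) F"
  have E: "?E k \<in> L2 P" for k by (rule measurable_past_L2[of _ k]) simp
  have gL: "g k \<in> L2 P" for k
    using L2_cong_AE[OF L2_diff[OF E E] g diff] .
  have "L2_tendsto P (\<lambda>m \<omega>. truncated_chaos n f m \<omega> + - expectation F) (\<lambda>\<omega>. F \<omega> + - expectation F) sequentially"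
    by (intro L2_tendsto_add truncated_chaos_tendsto FL exp L2_tendsto_const L2_const)
  then have "L2_tendsto P (\<lambda>m \<omega>. \<Sum>k<m. g k \<omega>) (\<lambda>\<omega>. F \<omega> - expectation F) sequentially"
  proof (rule L2_tendsto_cong_AE)
    show "\<forall>\<^sub>F m in sequentially. (\<lambda>\<omega>. \<Sum>k<m. g k \<omega>) \<in> borel_measurable P \<and>
        (AE \<omega> in P. (\<Sum>k<m. g k \<omega>) = truncated_chaos n f m \<omega> + - expectation F)"
    proof (rule always_eventually, intro allI conjI)
      fix m
      show "(\<lambda>\<omega>. \<Sum>k<m. g k \<omega>) \<in> borel_measurable P" using g by simp
      have "AE \<omega> in P. \<forall>k\<in>{..<m}. g k \<omega> = ?E (Suc k) \<omega> - ?E k \<omega>"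
        by (rule AE_finite_allI) (use diff in auto)
      then show "AE \<omega> in P. (\<Sum>k<m. g k \<omega>) = truncated_chaos n f m \<omega> + - expectation F"
        using cond_exp_zero[OF L2_integrable[OF FL]] cond_exp_chaos[OF FL exp, of m]
      proof eventually_elim
        case (elim \<omega>)
        then have "(\<Sum>k<m. g k \<omega>) = (\<Sum>k<m. ?E (Suc k) \<omega> - ?E k \<omega>)" by simp
        then show ?case
          using elim sum_lessThan_telescope[of "\<lambda>k. ?E k \<omega>" m] by simp
      qed
    qed
  qed (use L2_D(1)[OF FL] in auto)
  then show ?thesis using gL by (simp add: L2_sums_def)
qed

text \<open>
  The right hand side already has the shape of \<open>\<langle>D\<^sub>kF, Y\<^sub>k\<rangle>\<close>, with the multiple integrals truncated to
  times before \<open>k\<close>. The order \<open>r = 0\<close> contributes nothing to an increment.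
\<close>

lemma truncated_chaos_increment:
  assumes "\<And>r. r \<le> n \<Longrightarrow> f r \<in> sym_L2_kernels r"
  shows "truncated_chaos n f (Suc k) \<omega> - truncated_chaos n f k \<omega>
    = (\<Sum>j\<in>UNIV. (\<Sum>r=1..n. real r * partial_sum (r - 1) (kernel_slice (f r) j k) (below (r - 1) k) \<omega>) * walk v k \<omega> $ j)"
proof -
  define d where "d r = partial_sum r (f r) (below r (Suc k)) \<omega> - partial_sum r (f r) (below r k) \<omega>" for r
  have "truncated_chaos n f (Suc k) \<omega> - truncated_chaos n f k \<omega> = (\<Sum>r\<le>n. d r)"
    by (simp add: truncated_chaos_def d_def sum_subtractf)
  also have "\<dots> = (\<Sum>r=1..n. d r)"
    by (intro sum.mono_neutral_right) (auto simp: d_def below_0 not_le Suc_le_eq)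
  also have "\<dots> = (\<Sum>r=1..n. \<Sum>j\<in>UNIV. real r * partial_sum (r - 1) (kernel_slice (f r) j k) (below (r - 1) k) \<omega> * walk v k \<omega> $ j)"
  proof (intro sum.cong refl)
    fix r assume r: "r \<in> {1..n}"
    then have "Suc (r - 1) = r" by simp
    with partial_sum_increment[of "r - 1" "f r" k \<omega>] r assms[of r, THEN symmetric_kernel_D]
    show "d r = (\<Sum>j\<in>UNIV. real r * partial_sum (r - 1) (kernel_slice (f r) j k) (below (r - 1) k) \<omega> * walk v k \<omega> $ j)"
      by (simp add: d_def)
  qed
  also have "\<dots> = (\<Sum>j\<in>UNIV. (\<Sum>r=1..n. real r * partial_sum (r - 1) (kernel_slice (f r) j k) (below (r - 1) k) \<omega>) * walk v k \<omega> $ j)"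
    unfolding sum_distrib_right by (rule sum.swap)
  finally show ?thesis .
qed

text \<open>
  The gradient is computed from a chosen expansion, which is the same for all times \<open>k\<close>; proofs about it may
  use nothing about this expansion except that it represents \<open>F\<close>.
\<close>

lemma gradient_chosen_expansion:
  assumes "chaos_expansion P v F n f"
  obtains n f where "chaos_expansion P v F n f"
    and "\<And>k \<omega> j. gradient P v k F \<omega> $ j
      = (\<Sum>r=1..n. real r * multiple_integral P v (r - 1) (kernel_slice (f r) j k) \<omega>)"
proof -
  obtain n' f' where nf: "(SOME (n, f). chaos_expansion P v F n f) = (n', f')" by fastforce
  have "case (SOME (n, f). chaos_expansion P v F n f) of (n, f) \<Rightarrow> chaos_expansion P v F n f"
    by (rule someI_ex) (use assms in auto)
  then have "chaos_expansion P v F n' f'" by (simp add: nf)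
  then show ?thesis using that[of n' f'] by (simp add: gradient_def nf)
qed

lemma gradient_component_L2:
  assumes exp: "chaos_expansion P v F n f"
  shows "(\<lambda>\<omega>. gradient P v k F \<omega> $ j) \<in> L2 P"
proof -
  obtain n f where exp: "chaos_expansion P v F n f"
    and D: "\<And>k \<omega> j. gradient P v k F \<omega> $ j
      = (\<Sum>r=1..n. real r * multiple_integral P v (r - 1) (kernel_slice (f r) j k) \<omega>)"
    by (rule gradient_chosen_expansion[OF exp]) (rule that)
  have "square_summable (r - 1) (kernel_slice (f r) j k)" if "r \<in> {1..n}" for r
    using that exp by (intro square_summable_kernel_slice) (auto simp: chaos_expansion_def)
  then show ?thesis unfolding D by (intro L2_sum L2_cmult multiple_integral_L2)
qed

text \<open>
  Conditioning on \<open>past P k\<close> truncates the integrals in \<open>D\<^sub>kF\<close> to times before \<open>k\<close>, which gives exactly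
  the increment of \<open>truncated_chaos_increment\<close>.
\<close>

lemma cond_exp_gradient:
  assumes F: "F \<in> L2 P" and exp: "chaos_expansion P v F n f"
  shows "AE \<omega> in P. vec_cond_exp P (past P k) (gradient P v k F) \<omega> \<bullet> walk v k \<omega>
    = real_cond_exp P (past P (Suc k)) F \<omega> - real_cond_exp P (past P k) F \<omega>"
proof -
  obtain n f where exp: "chaos_expansion P v F n f"
    and D: "\<And>k \<omega> j. gradient P v k F \<omega> $ j
      = (\<Sum>r=1..n. real r * multiple_integral P v (r - 1) (kernel_slice (f r) j k) \<omega>)"
    by (rule gradient_chosen_expansion[OF exp]) (rule that)
  have f: "f r \<in> sym_L2_kernels r" if "r \<le> n" for r using exp that by (simp add: chaos_expansion_def)
  have ss: "square_summable (r - 1) (kernel_slice (f r) j k)" if "r \<in> {1..n}" for r j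
    using that f by (intro square_summable_kernel_slice) auto
  let ?J = "\<lambda>r j. partial_sum (r - 1) (kernel_slice (f r) j k) (below (r - 1) k)"
  have comp: "AE \<omega> in P. real_cond_exp P (past P k) (\<lambda>\<omega>. gradient P v k F \<omega> $ j) \<omega>
      = (\<Sum>r=1..n. real r * ?J r j \<omega>)" for j
  proof -
    \<comment> \<open>set to zero outside of the range of the sum, so that every member of the family is integrable\<close>
    define I where "I r = (if r \<in> {1..n} then multiple_integral P v (r - 1) (kernel_slice (f r) j k) else (\<lambda>_. 0))" for r
    have I: "I r \<in> L2 P" for r using ss multiple_integral_L2 L2_zero by (auto simp: I_def)
    have eq: "(\<lambda>\<omega>. gradient P v k F \<omega> $ j) = (\<lambda>\<omega>. \<Sum>r=1..n. real r * I r \<omega>)"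
      by (simp add: D I_def)
    have "AE \<omega> in P. real_cond_exp P (past P k) (\<lambda>\<omega>. \<Sum>r=1..n. real r * I r \<omega>) \<omega>
        = (\<Sum>r=1..n. real_cond_exp P (past P k) (\<lambda>\<omega>. real r * I r \<omega>) \<omega>)"
      by (intro past.real_cond_exp_sum L2_integrable L2_cmult I)
    moreover have "AE \<omega> in P. \<forall>r\<in>{1..n}. real_cond_exp P (past P k) (\<lambda>\<omega>. real r * I r \<omega>) \<omega> = real r * ?J r j \<omega>"
    proof (rule AE_finite_allI)
      fix r assume r: "r \<in> {1..n}"
      have "AE \<omega> in P. real_cond_exp P (past P k) (\<lambda>\<omega>. real r * I r \<omega>) \<omega> = real r * real_cond_exp P (past P k) (I r) \<omega>"
        by (intro past.real_cond_exp_cmult L2_integrable I)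
      moreover have "AE \<omega> in P. real_cond_exp P (past P k) (I r) \<omega> = ?J r j \<omega>"
        using cond_exp_multiple_integral[OF ss[OF r]] r by (simp add: I_def)
      ultimately show "AE \<omega> in P. real_cond_exp P (past P k) (\<lambda>\<omega>. real r * I r \<omega>) \<omega> = real r * ?J r j \<omega>"
        by eventually_elim simp
    qed simp
    ultimately show ?thesis unfolding eq by eventually_elim simp
  qed
  have "AE \<omega> in P. \<forall>j\<in>UNIV. real_cond_exp P (past P k) (\<lambda>\<omega>. gradient P v k F \<omega> $ j) \<omega>
      = (\<Sum>r=1..n. real r * ?J r j \<omega>)"
    by (rule AE_finite_allI[OF finite comp])
  then show ?thesis
    using cond_exp_chaos[OF F exp, of k] cond_exp_chaos[OF F exp, of "Suc k"]
  proof eventually_elim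
    case (elim \<omega>)
    then show ?case
      using truncated_chaos_increment[of n f k \<omega>, OF f]
      by (simp add: vec_cond_exp_def inner_vec_def)
  qed
qed

text \<open>
  The kernel value is a positive multiple of the inner product of \<open>G\<close> with the monomial. If the monomial has
  a time at or after \<open>k\<close>, its conditional mean given \<open>past P k\<close> is zero, so it is orthogonal to \<open>G\<close>.
\<close>

lemma kernel_vanishes:
  assumes G: "G \<in> L2 P" and exp: "chaos_expansion P v G n f"
    and past: "AE \<omega> in P. real_cond_exp P (past P k) G \<omega> = G \<omega>"
    and mem: "r \<le> n" "ks \<in> multi_indices r" "is \<in> \<Delta> r - below r k"
  shows "f r ks is = 0"
proof -
  let ?t = "monomial ks is" and ?m = "Suc (Max (set is))"
  let ?E = "\<lambda>k. real_cond_exp P (past P k)"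
  have len: "length ks = length is" "distinct is" using mem by (auto simp: multi_indices_def \<Delta>_def)
  have "set is \<subseteq> {..<?m}" by (auto simp: less_Suc_eq_le)
  then have "is": "is \<in> below r ?m" using mem by (auto simp: below_def)
  have t: "?t \<in> borel_measurable (past P ?m)"
  proof (rule monomial_measurable)
    fix l assume "l < length ks"
    then show "is ! l < ?m" using len by (simp add: less_Suc_eq_le)
  qed
  have tP: "?t \<in> borel_measurable P" by (rule measurable_past[OF t])
  have fs: "f r \<in> sym_L2_kernels r" if "r \<le> n" for r using exp that by (simp add: chaos_expansion_def)
  \<comment> \<open>\<open>?m\<close> lies beyond all times of the monomial, so truncating \<open>G\<close> at \<open>?m\<close> does not change the inner product\<close>
  have "expectation (\<lambda>\<omega>. ?t \<omega> * truncated_chaos n f ?m \<omega>) = expectation (\<lambda>\<omega>. ?t \<omega> * ?E ?m G \<omega>)"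
    using cond_exp_chaos[OF G exp, of ?m] tP measurable_past[OF truncated_chaos_measurable]
    by (intro integral_cong_AE) auto
  also have "\<dots> = expectation (\<lambda>\<omega>. ?t \<omega> * G \<omega>)"
    by (rule past.real_cond_exp_intg[OF L2_mult_integrable[OF monomial_L2 G] t L2_D(1)[OF G]])
  also have "\<dots> = expectation (\<lambda>\<omega>. ?E k G \<omega> * ?t \<omega>)"
    using past tP L2_D(1)[OF G] by (intro integral_cong_AE) (auto simp: mult.commute)
  also have "\<dots> = expectation (\<lambda>\<omega>. ?E k G \<omega> * ?E k ?t \<omega>)"
    by (rule past.real_cond_exp_intg(2)[symmetric])
      (use tP in \<open>simp_all add: L2_mult_integrable[OF measurable_past_L2[OF borel_measurable_cond_exp] monomial_L2]\<close>)
  also have "\<dots> = 0"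
  proof -
    have "AE \<omega> in P. ?E k G \<omega> * ?E k ?t \<omega> = 0"
      using cond_exp_monomial[OF len, of k] mem by (auto simp: below_def)
    then show ?thesis by (rule integral_eq_zero_AE)
  qed
  finally have zero: "expectation (\<lambda>\<omega>. ?t \<omega> * truncated_chaos n f ?m \<omega>) = 0" .
  define C where "C = {(ks' :: 'd list, is') \<in> multi_indices r \<times> below r ?m.
    map_of (zip is' ks') = map_of (zip is ks)}"
  have "expectation (\<lambda>\<omega>. ?t \<omega> * truncated_chaos n f ?m \<omega>)
      = (\<Sum>q\<le>n. expectation (\<lambda>\<omega>. partial_sum q (f q) (below q ?m) \<omega> * ?t \<omega>))"
    unfolding truncated_chaos_def
    using L2_mult_integrable[OF partial_sum_L2 monomial_L2]
    by (simp add: sum_distrib_left mult.commute[of "?t _"])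
  also have "\<dots> = (\<Sum>q\<le>n. if q = r then real (card C) * f r ks is else 0)"
    unfolding C_def using mem fs by (intro sum.cong refl)
      (auto simp: expectation_partial_sum_monomial[OF symmetric_kernel_D finite_below below_subset])
  also have "\<dots> = real (card C) * f r ks is" using mem by simp
  finally have "real (card C) * f r ks is = 0" using zero by simp
  moreover have "card C \<noteq> 0"
  proof -
    have "(ks, is) \<in> C" using "is" mem by (simp add: C_def)
    moreover have "finite C"
      by (rule finite_subset[of _ "multi_indices r \<times> below r ?m"])
        (auto simp: C_def finite_multi_indices finite_below)
    ultimately show ?thesis by auto
  qed
  ultimately show ?thesis by simp
qed

text \<open>
  This makes the gradient of a conditional expectation meaningful: the truncated kernels
  provide an expansion.
\<close>

lemma chaos_expansion_cond_exp:
  assumes F: "F \<in> L2 P" and exp: "chaos_expansion P v F n f"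
  shows "chaos_expansion P v (real_cond_exp P (past P k) F) n
    (\<lambda>r ks is. if set is \<subseteq> {..<k} then f r ks is else 0)"
proof -
  let ?f = "\<lambda>r ks is. if set is \<subseteq> {..<k} then f r ks is else 0"
  have f: "?f r \<in> sym_L2_kernels r" if "r \<le> n" for r
    using exp that by (intro sym_L2_truncate) (simp add: chaos_expansion_def)
  have "AE \<omega> in P. \<forall>r\<in>{..n}. multiple_integral P v r (?f r) \<omega> = partial_sum r (f r) (below r k) \<omega>"
  proof (rule AE_finite_allI)
    fix r assume "r \<in> {..n}"
    then have "AE \<omega> in P. multiple_integral P v r (?f r) \<omega> = partial_sum r (?f r) (below r k) \<omega>"
      using f by (intro multiple_integral_supported square_summable_D) (auto simp: below_def)
    moreover have "partial_sum r (?f r) (below r k) = partial_sum r (f r) (below r k)"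
      unfolding partial_sum_def[abs_def] by (intro ext sum.cong refl) (auto simp: below_def)
    ultimately show "AE \<omega> in P. multiple_integral P v r (?f r) \<omega> = partial_sum r (f r) (below r k) \<omega>" by simp
  qed simp
  then have "AE \<omega> in P. real_cond_exp P (past P k) F \<omega> = (\<Sum>r\<le>n. multiple_integral P v r (?f r) \<omega>)"
    using cond_exp_chaos[OF F exp, of k] by eventually_elim (simp add: truncated_chaos_def)
  then show ?thesis using f by (simp add: chaos_expansion_def)
qed

text \<open>
  Whichever expansion of \<open>G k\<close> the gradient uses, its kernels vanish beyond time \<open>k\<close>. The slice at \<open>k\<close>
  also vanishes at tuples that contain \<open>k\<close>, so it lives strictly before \<open>k\<close> and its
  multiple integral equals the truncated one.
\<close>

lemma gradient_cond_exp:
  assumes F: "F \<in> L2 P" and exp: "chaos_expansion P v F n f"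
  defines "G k \<equiv> real_cond_exp P (past P (Suc k)) F"
  shows "AE \<omega> in P. gradient P v k (G k) \<omega> \<bullet> walk v k \<omega>
    = real_cond_exp P (past P (Suc k)) F \<omega> - real_cond_exp P (past P k) F \<omega>"
proof -
  have GL: "G k \<in> L2 P" unfolding G_def by (rule measurable_past_L2[of _ "Suc k"]) simp
  obtain n f where exp: "chaos_expansion P v (G k) n f"
    and D: "\<And>i \<omega> j. gradient P v i (G k) \<omega> $ j
      = (\<Sum>r=1..n. real r * multiple_integral P v (r - 1) (kernel_slice (f r) j i) \<omega>)"
    by (rule gradient_chosen_expansion[OF chaos_expansion_cond_exp[OF F exp, of "Suc k"], folded G_def])
      (rule that)
  have f: "f r \<in> sym_L2_kernels r" if "r \<le> n" for r using exp that by (simp add: chaos_expansion_def)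
  have past: "AE \<omega> in P. real_cond_exp P (past P (Suc k)) (G k) \<omega> = G k \<omega>"
    by (rule past.real_cond_exp_F_meas[OF L2_integrable[OF GL]]) (simp add: G_def)
  have zero: "f r ks is = 0" if "r \<le> n" "ks \<in> multi_indices r" "is \<in> \<Delta> r - below r (Suc k)" for r ks "is"
    by (rule kernel_vanishes[OF GL exp past that])
  let ?J = "\<lambda>r j. partial_sum (r - 1) (kernel_slice (f r) j k) (below (r - 1) k)"
  have slice: "AE \<omega> in P. multiple_integral P v (r - 1) (kernel_slice (f r) j k) \<omega> = ?J r j \<omega>"
    if r: "r \<in> {1..n}" for r j
  proof (rule multiple_integral_supported)
    show "square_summable (r - 1) (kernel_slice (f r) j k)"
      using r f by (intro square_summable_kernel_slice) auto
    fix ks :: "'d list" and "is" assume mem: "ks \<in> multi_indices (r - 1)" "is \<in> \<Delta> (r - 1) - below (r - 1) k"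
    show "kernel_slice (f r) j k ks is = 0"
    proof (cases "k \<in> set is")
      case False
      obtain i where "i \<in> set is" "\<not> i < k" using mem by (auto simp: below_def)
      with False have "\<not> set is \<subseteq> {..<Suc k}" by (metis less_antisym lessThan_iff subsetD)
      then show ?thesis
        using mem r False by (auto simp: kernel_slice_def below_def \<Delta>_def multi_indices_def intro!: zero)
    qed (simp add: kernel_slice_def)
  qed
  have "AE \<omega> in P. \<forall>r\<in>{1..n}. \<forall>j\<in>UNIV. multiple_integral P v (r - 1) (kernel_slice (f r) j k) \<omega> = ?J r j \<omega>"
    by (intro AE_finite_allI slice) auto
  moreover have "AE \<omega> in P. real_cond_exp P (past P k) (G k) \<omega> = real_cond_exp P (past P k) F \<omega>"
    unfolding G_def by (rule past.real_cond_exp_nested_subalg[OF subalgebra_past past_mono L2_integrable[OF F]]) simp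
  ultimately show ?thesis
    using cond_exp_chaos[OF GL exp, of k] cond_exp_chaos[OF GL exp, of "Suc k"] past
  proof eventually_elim
    case (elim \<omega>)
    then show ?case
      using truncated_chaos_increment[of n f k \<omega>, OF f]
      by (simp add: D[unfolded G_def] inner_vec_def G_def)
  qed
qed

end

theorem proposition7p1:
  fixes P :: "(nat \<Rightarrow> nat) measure"
    and v :: "nat \<Rightarrow> nat \<Rightarrow> (nat \<Rightarrow> nat) \<Rightarrow> real ^ 'd"
    and F :: "(nat \<Rightarrow> nat) \<Rightarrow> real"
  assumes "obtuse_random_walk P v"
    and "F \<in> chaos_space P v"
  shows "L2_sums P (\<lambda>k \<omega>. vec_cond_exp P (past P k) (gradient P v k F) \<omega> \<bullet> walk v k \<omega>)
           (\<lambda>\<omega>. F \<omega> - (\<integral>\<omega>'. F \<omega>' \<partial>P))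
       \<and> L2_sums P (\<lambda>k \<omega>. gradient P v k (real_cond_exp P (past P (Suc k)) F) \<omega> \<bullet> walk v k \<omega>)
           (\<lambda>\<omega>. F \<omega> - (\<integral>\<omega>'. F \<omega>' \<partial>P))"
proof -
  interpret obtuse_random_walk P v by fact
  obtain n f where F: "F \<in> L2 P" and exp: "chaos_expansion P v F n f"
    using assms(2) by (auto simp: chaos_space_def)
  have walk: "(\<lambda>\<omega>. walk v k \<omega> $ j) \<in> borel_measurable P" for k j
    by (rule measurable_past[OF walk_measurable])
  have D: "(\<lambda>\<omega>. gradient P v k (real_cond_exp P (past P (Suc k)) F) \<omega> $ j) \<in> borel_measurable P" for k j
    by (rule L2_D(1)[OF gradient_component_L2[OF chaos_expansion_cond_exp[OF F exp]]])
  show ?thesis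
  proof (intro conjI L2_sums_martingale_differences[OF assms(2)])
    show "(\<lambda>\<omega>. vec_cond_exp P (past P k) (gradient P v k F) \<omega> \<bullet> walk v k \<omega>) \<in> borel_measurable P" for k
      unfolding inner_vec_def vec_cond_exp_def using walk by simp
    show "(\<lambda>\<omega>. gradient P v k (real_cond_exp P (past P (Suc k)) F) \<omega> \<bullet> walk v k \<omega>) \<in> borel_measurable P" for k
      unfolding inner_vec_def using walk D by simp
  qed (rule cond_exp_gradient[OF F exp] gradient_cond_exp[OF F exp])+
qed

end
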